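(* Let $\mathcal{H}$ be a complex Hilbert space, let $T$ be a positive bounded linear operator on $\mathcal{H}$, and let $\alpha,\beta$ be two distinct positive real numbers. Let $F$ be a semispectral measure on the Borel $\sigma$-algebra of $\mathbb{R}_+=[0,\infty)$, with values in the bounded linear operators on $\mathcal{H}$, and assume that $F$ has compact support. Then the following conditions are equivalent: (i) $F$ is a spectral measure; (ii) $T^n=\int_{\mathbb{R}_+}x^n\,F(\mathrm{d}x)$ for all integers $n\geq 0$; (iii) $T^p=\int_{\mathbb{R}_+}x^p\,F(\mathrm{d}x)$ for all real $p\geq 0$; (iv) $T^p=\int_{\mathbb{R}_+}x^p\,F(\mathrm{d}x)$ for $p=\alpha$ and $p=\beta$.
   Context: All operators are bounded linear operators on complex Hilbert spaces; $\boldsymbol{B}(\mathcal{H})$ is the algebra of all such operators on $\mathcal{H}$. An operator $T$ is positive if $\langle Th,h\rangle\geq 0$ for all $h\in\mathcal{H}$. For a positive operator $T$ and a real $p\ge 0$, $T^p$ is defined by the Borel functional calculus, with $0^0=1$ (so $T^0=I_{\mathcal{H}}$, the identity operator on $\mathcal{H}$). A semispectral measure on the Borel $\sigma$-algebra $\mathfrak{B}(\mathbb{R}_+)$ is a map $F\colon\mathfrak{B}(\mathbb{R}_+)\to\boldsymbol{B}(\mathcal{H})$ such that $\langle F(\cdot)h,h\rangle$ is a (countably additive) positive measure for every $h\in\mathcal{H}$ and $F(\mathbb{R}_+)=I_{\mathcal{H}}$. It has compact support if $F(\mathbb{R}_+\setminus K)=0$ for some compact $K\subset\mathbb{R}_+$.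 It is a spectral measure if $F(\varDelta)$ is an orthogonal projection for every Borel set $\varDelta\subseteq\mathbb{R}_+$. For a Borel function $f\colon\mathbb{R}_+\to\mathbb{C}$ with $\int_{\mathbb{R}_+}|f(x)|\,\langle F(\mathrm{d}x)h,h\rangle<\infty$ for all $h\in\mathcal{H}$, $\int_{\mathbb{R}_+}f(x)\,F(\mathrm{d}x)$ denotes the unique operator in $\boldsymbol{B}(\mathcal{H})$ such that $\big\langle\int_{\mathbb{R}_+}f(x)\,F(\mathrm{d}x)\,h,h\big\rangle=\int_{\mathbb{R}_+}f(x)\,\langle F(\mathrm{d}x)h,h\rangle$ for all $h\in\mathcal{H}$.
   Formalization: Condition (i) is read as "F is the spectral measure of T", i.e. F is a spectral measure and T is the integral of x with respect to F; as printed, (i) does not mention T and the equivalence fails (T = 0, F the Dirac measure at 1). *)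

theory Defs
  imports "HOL-Analysis.Analysis"
begin

class complex_vector = real_vector +
  fixes scaleC :: "complex \<Rightarrow> 'a \<Rightarrow> 'a"  (infixr \<open>*\<^sub>C\<close> 75)
  assumes scaleC_add_right: "a *\<^sub>C (x + y) = a *\<^sub>C x + a *\<^sub>C y"
    and scaleC_add_left: "(a + b) *\<^sub>C x = a *\<^sub>C x + b *\<^sub>C x"
    and scaleC_scaleC: "a *\<^sub>C b *\<^sub>C x = (a * b) *\<^sub>C x"
    and scaleR_scaleC: "r *\<^sub>R x = complex_of_real r *\<^sub>C x"

text \<open>The inner product is linear in its first argument. Its nonnegativity and definiteness follow
  from the last axiom and the norm axioms of \<^class>\<open>real_normed_vector\<close>.\<close>

class complex_inner = complex_vector + real_normed_vector +
  fixes cinner :: "'a \<Rightarrow> 'a \<Rightarrow> complex"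
  assumes cinner_commute: "cinner x y = cnj (cinner y x)"
    and cinner_add_left: "cinner (x + y) z = cinner x z + cinner y z"
    and cinner_scaleC_left: "cinner (a *\<^sub>C x) y = a * cinner x y"
    and norm_eq_sqrt_cinner: "norm x = sqrt (Re (cinner x x))"

class chilbert_space = complex_inner + complete_space

instantiation complex :: chilbert_space
begin

definition scaleC_complex :: "complex \<Rightarrow> complex \<Rightarrow> complex"
  where "scaleC_complex a x = a * x"

definition cinner_complex :: "complex \<Rightarrow> complex \<Rightarrow> complex"
  where "cinner_complex x y = x * cnj y"

instance
  by standard
    (simp_all add: scaleC_complex_def cinner_complex_def algebra_simps scaleR_conv_of_real
      cmod_def power2_eq_square)

end

definition bounded_clinear :: "('a::complex_inner \<Rightarrow> 'a) \<Rightarrow> bool"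
  where "bounded_clinear T \<longleftrightarrow> bounded_linear T \<and> (\<forall>c x. T (c *\<^sub>C x) = c *\<^sub>C T x)"

definition positive_op :: "('a::complex_inner \<Rightarrow> 'a) \<Rightarrow> bool"
  where "positive_op T \<longleftrightarrow> bounded_clinear T \<and> (\<forall>h. cinner (T h) h \<in> \<real>\<^sub>\<ge>\<^sub>0)"

definition orthogonal_projection :: "('a::complex_inner \<Rightarrow> 'a) \<Rightarrow> bool"
  where "orthogonal_projection P \<longleftrightarrow> bounded_clinear P \<and> P \<circ> P = P \<and>
    (\<forall>x y. cinner (P x) y = cinner x (P y))"

text \<open>An operator-valued set function is a total function on \<^typ>\<open>real set\<close>; only its values on
  \<^term>\<open>sets borel_Rplus\<close>, i.e. on the Borel subsets of \<^term>\<open>{0..} :: real set\<close>, are relevant.\<close>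

definition borel_Rplus :: "real measure"
  where "borel_Rplus = restrict_space borel {0..}"

definition semispectral_measure :: "(real set \<Rightarrow> 'a::complex_inner \<Rightarrow> 'a) \<Rightarrow> bool"
  where "semispectral_measure F \<longleftrightarrow>
    (\<forall>A \<in> sets borel_Rplus. bounded_clinear (F A)) \<and>
    (\<forall>h. (\<forall>A \<in> sets borel_Rplus. cinner (F A h) h \<in> \<real>\<^sub>\<ge>\<^sub>0) \<and>
         measure_space {0..} (sets borel_Rplus) (\<lambda>A. ennreal (Re (cinner (F A h) h)))) \<and>
    F {0..} = id"

definition spectral_measure :: "(real set \<Rightarrow> 'a::complex_inner \<Rightarrow> 'a) \<Rightarrow> bool"
  where "spectral_measure F \<longleftrightarrow>
    semispectral_measure F \<and> (\<forall>A \<in> sets borel_Rplus. orthogonal_projection (F A))"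

definition compactly_supported :: "(real set \<Rightarrow> 'a::complex_inner \<Rightarrow> 'a) \<Rightarrow> bool"
  where "compactly_supported F \<longleftrightarrow> (\<exists>K. compact K \<and> K \<subseteq> {0..} \<and> F ({0..} - K) = (\<lambda>_. 0))"

text \<open>The measure \<open>\<langle>F(\<cdot>)h,h\<rangle>\<close>.\<close>

definition scalar_measure :: "(real set \<Rightarrow> 'a::complex_inner \<Rightarrow> 'a) \<Rightarrow> 'a \<Rightarrow> real measure"
  where "scalar_measure F h =
    measure_of {0..} (sets borel_Rplus) (\<lambda>A. ennreal (Re (cinner (F A h) h)))"

definition has_op_integral ::
    "(real set \<Rightarrow> 'a::complex_inner \<Rightarrow> 'a) \<Rightarrow> (real \<Rightarrow> complex) \<Rightarrow> ('a \<Rightarrow> 'a) \<Rightarrow> bool"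
  where "has_op_integral F f S \<longleftrightarrow> bounded_clinear S \<and>
    (\<forall>h. integrable (scalar_measure F h) f \<and>
         cinner (S h) h = integral\<^sup>L (scalar_measure F h) f)"

definition op_integral ::
    "(real set \<Rightarrow> 'a::complex_inner \<Rightarrow> 'a) \<Rightarrow> (real \<Rightarrow> complex) \<Rightarrow> 'a \<Rightarrow> 'a"
  where "op_integral F f = (THE S. has_op_integral F f S)"

definition is_spectral_measure_of ::
    "(real set \<Rightarrow> 'a::complex_inner \<Rightarrow> 'a) \<Rightarrow> ('a \<Rightarrow> 'a) \<Rightarrow> bool"
  where "is_spectral_measure_of E T \<longleftrightarrow>
    spectral_measure E \<and> has_op_integral E (\<lambda>x. complex_of_real x) T"

text \<open>Borel functional calculus \<open>f(T) = \<integral> f dE\<close> with \<open>E\<close> the spectral measure of \<open>T\<close>. As a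
  function on \<^typ>\<open>real set\<close>, \<open>E\<close> is determined by \<open>T\<close> only on Borel sets, so the definite
  description is applied to the operator and not to \<open>E\<close>.\<close>

definition borel_calculus :: "(real \<Rightarrow> complex) \<Rightarrow> ('a::complex_inner \<Rightarrow> 'a) \<Rightarrow> 'a \<Rightarrow> 'a"
  where "borel_calculus f T = (THE S. \<exists>E. is_spectral_measure_of E T \<and> has_op_integral E f S)"

text \<open>The function \<open>x\<^sup>p\<close> on the half-line with \<open>0\<^sup>0 = 1\<close>, whereas \<open>0 powr 0 = 0\<close> in the library.\<close>

definition rpow :: "real \<Rightarrow> real \<Rightarrow> real"
  where "rpow x p = (if p = 0 then 1 else x powr p)"

definition op_power :: "('a::complex_inner \<Rightarrow> 'a) \<Rightarrow> real \<Rightarrow> 'a \<Rightarrow> 'a"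
  where "op_power T p = borel_calculus (\<lambda>x. complex_of_real (rpow x p)) T"

end

theory Submission
  imports Defs "HOL-Probability.Probability"
begin

text \<open>
  The spectral measure of \<open>T\<close> comes from Hausdorff's moment problem: if \<open>0 \<le> T \<le> M\<close>, the numbers
  \<open>\<langle>T\<^sup>k (M - T)\<^sup>l h, h\<rangle>\<close> are nonnegative, so the moments \<open>\<langle>T\<^sup>n h, h\<rangle>\<close> belong to a measure on \<open>[0, M]\<close>.
  Operators for bounded Borel functions, and their multiplicativity, are then reached from the
  polynomials by bounded monotone limits.

  The heart of the matter is that two moments, of orders \<open>a < b\<close>, force \<open>F = E\<close> for a spectral measure \<open>E\<close>.
  For \<open>y = x\<^sup>b + \<lambda>\<close> and all vectors, \<open>2 Re \<langle>h, k\<rangle> \<le> \<integral> 1/y d\<langle>F h, h\<rangle> + \<integral> y d\<langle>F k, k\<rangle>\<close>. The last term is the same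
  for \<open>F\<close> and \<open>E\<close>, and \<open>k = \<integral> 1/y dE h\<close> gives \<open>\<integral> 1/y d\<langle>E h, h\<rangle> \<le> \<integral> 1/y d\<langle>F h, h\<rangle>\<close>. Since \<open>x\<^sup>a\<close> is a
  mixture over \<open>\<lambda>\<close> of the functions \<open>x\<^sup>b / (x\<^sup>b + \<lambda>) = 1 - \<lambda>/y\<close>, equality of the moments of order \<open>a\<close> gives equality
  for almost all \<open>\<lambda>\<close>, and these transforms determine the scalar measures. Uniqueness of the spectral
  measure is the case of the orders 1 and 2.
\<close>

section \<open>Operators and their quadratic forms\<close>

text \<open>The obstacle is that \<open>F\<close> is not multiplicative: integrals against it cannot
  be composed, only their quadratic forms compared. The inequality with \<open>1/y\<close> survives
  because it uses nothing but positivity of each \<open>F A\<close> and additivity. It amounts to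
  the operator Jensen inequality for the inverse (the compression of an inverse dominates the
  inverse of the compression), obtained without a dilation space. One common moment thus gives only
  an order relation between the two measures; the second moment turns it into its case of equality.

  Over complex scalars an operator is determined by its quadratic form, so all operators are handled
  through scalar measures. Representing operators are produced as strong limits of monotone
  sequences, not from bounded sesquilinear forms.

  Both sides of each equation in the theorem are definite descriptions. They carry information only
  once an operator with the right form is known to exist, so existence is proved separately, for
  \<open>E\<close> and also for \<open>F\<close>.\<close>

lemma cinner_add_right: "cinner x (y + z) = cinner x y + cinner x z"
  by (subst (1 2 3) cinner_commute) (simp add: cinner_add_left)

lemma cinner_scaleC_right: "cinner x (a *\<^sub>C y) = cnj a * cinner x y"
  by (subst (1 2) cinner_commute) (simp add: cinner_scaleC_left)

lemma cinner_scaleR_left: "cinner (r *\<^sub>R x) y = of_real r * cinner x y"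
  by (simp add: scaleR_scaleC cinner_scaleC_left)

lemma cinner_scaleR_right: "cinner x (r *\<^sub>R y) = of_real r * cinner x y"
  by (simp add: scaleR_scaleC cinner_scaleC_right)

lemma cinner_zero_left [simp]: "cinner 0 y = 0"
  using cinner_scaleR_left[of 0 0 y] by simp

lemma cinner_zero_right [simp]: "cinner x 0 = 0"
  using cinner_scaleR_right[of x 0 0] by simp

lemma cinner_minus_left: "cinner (- x) y = - cinner x y"
  using cinner_scaleR_left[of "-1" x y] by simp

lemma cinner_minus_right: "cinner x (- y) = - cinner x y"
  using cinner_scaleR_right[of x "-1" y] by simp

lemma cinner_diff_left: "cinner (x - y) z = cinner x z - cinner y z"
  using cinner_add_left[of x "- y" z] by (simp add: cinner_minus_left)

lemma cinner_diff_right: "cinner x (y - z) = cinner x y - cinner x z"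
  using cinner_add_right[of x y "- z"] by (simp add: cinner_minus_right)

lemmas cinner_simps = cinner_add_left cinner_add_right cinner_diff_left cinner_diff_right
  cinner_scaleC_left cinner_scaleC_right cinner_scaleR_left cinner_scaleR_right
  cinner_minus_left cinner_minus_right

lemma Im_cinner_self [simp]: "Im (cinner x x) = 0"
  using cinner_commute[of x x] by (simp add: complex_eq_iff)

lemma Re_cinner_self_nonneg: "0 \<le> Re (cinner x x)"
  using norm_eq_sqrt_cinner[of x] norm_ge_zero[of x] by (metis real_sqrt_ge_0_iff)

lemma Re_cinner_self: "Re (cinner x x) = (norm x)\<^sup>2"
  by (simp add: norm_eq_sqrt_cinner Re_cinner_self_nonneg)

lemma cinner_self: "cinner x x = of_real ((norm x)\<^sup>2)"
  by (simp add: complex_eq_iff Re_cinner_self del: of_real_power)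

lemma Re_cinner_commute: "Re (cinner x y) = Re (cinner y x)"
  by (subst cinner_commute) simp

lemma Re_cinner_le_norm: "Re (cinner x y) \<le> norm x * norm y"
proof (cases "x = 0 \<or> y = 0")
  case False
  have "0 \<le> Re (cinner (norm y *\<^sub>R x - norm x *\<^sub>R y) (norm y *\<^sub>R x - norm x *\<^sub>R y))"
    by (rule Re_cinner_self_nonneg)
  also have "\<dots> = 2 * (norm x * norm y) * (norm x * norm y - Re (cinner x y))"
    by (simp add: cinner_simps Re_cinner_self Re_cinner_commute[of y x] algebra_simps power2_eq_square)
  finally show ?thesis using False by (simp add: zero_le_mult_iff mult_le_0_iff)
qed auto

lemma bounded_clinear_linear: "bounded_clinear S \<Longrightarrow> linear S"
  by (simp add: bounded_clinear_def bounded_linear.linear)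

lemma bounded_clinearI:
  assumes "\<And>x y. S (x + y) = S x + S y" "\<And>c x. S (c *\<^sub>C x) = c *\<^sub>C S x"
    "\<And>x. norm (S x) \<le> norm x * K"
  shows "bounded_clinear S"
  unfolding bounded_clinear_def
  by (intro conjI bounded_linear_intro[where K = K]) (auto simp: assms scaleR_scaleC)

lemma bounded_clinear_id: "bounded_clinear id"
  by (rule bounded_clinearI[where K = 1]) auto

lemma bounded_clinear_comp: "bounded_clinear S \<Longrightarrow> bounded_clinear R \<Longrightarrow> bounded_clinear (S \<circ> R)"
  by (auto simp: bounded_clinear_def o_def intro: bounded_linear_compose)

lemma bounded_clinear_add:
  "bounded_clinear S \<Longrightarrow> bounded_clinear R \<Longrightarrow> bounded_clinear (\<lambda>h. S h + R h)"
  by (auto simp: bounded_clinear_def bounded_linear_add scaleC_add_right)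

lemma bounded_clinear_scaleR: "bounded_clinear S \<Longrightarrow> bounded_clinear (\<lambda>h. r *\<^sub>R S h)"
  using bounded_linear_const_scaleR[of S r]
  by (auto simp: bounded_clinear_def scaleR_scaleC scaleC_scaleC mult.commute)

lemma bounded_clinear_diff:
  "bounded_clinear S \<Longrightarrow> bounded_clinear R \<Longrightarrow> bounded_clinear (\<lambda>h. S h - R h)"
  using bounded_clinear_add[of S "\<lambda>h. (-1) *\<^sub>R R h"] bounded_clinear_scaleR[of R "-1"] by simp

lemma bounded_clinear_funpow: "bounded_clinear S \<Longrightarrow> bounded_clinear (S ^^ n)"
  by (induction n) (auto simp: bounded_clinear_id intro: bounded_clinear_comp)

lemma bounded_clinear_simps:
  assumes "bounded_clinear S"
  shows "S (x + y) = S x + S y" "S (x - y) = S x - S y" "S (c *\<^sub>C x) = c *\<^sub>C S x"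
    "S (r *\<^sub>R x) = r *\<^sub>R S x" "S 0 = 0" "S (- x) = - S x"
  using assms bounded_clinear_linear[OF assms]
  by (auto simp: bounded_clinear_def linear_add linear_diff linear_0 linear_neg scaleR_scaleC)

lemma bounded_clinear_norm_bound:
  assumes "bounded_clinear S"
  obtains K where "K > 0" "\<And>x. norm (S x) \<le> K * norm x"
  using assms bounded_linear.pos_bounded[of S] by (auto simp: bounded_clinear_def mult.commute)

text \<open>Polarisation at \<open>k\<close> and at \<open>\<i> *\<^sub>C k\<close> gives the sum
  and the difference of the two mixed terms, so both vanish. Complex scalars are essential: a
  quarter turn of the real plane has zero form.\<close>

lemma quadratic_form_eq_0:
  assumes S: "bounded_clinear S" and 0: "\<And>h. cinner (S h) h = 0"
  shows "S = (\<lambda>_. 0)"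
proof
  fix h
  let ?k = "S h"
  have a: "cinner (S h) k + cinner (S k) h = 0" for k
    using 0[of "h + k"] 0[of h] 0[of k] by (simp add: cinner_simps bounded_clinear_simps[OF S] add.commute)
  from a[of ?k] a[of "\<i> *\<^sub>C ?k"] have "cinner (S h) ?k = 0"
    by (simp add: cinner_simps bounded_clinear_simps[OF S] add_eq_0_iff2)
  then show "S h = 0" by (simp add: cinner_self)
qed

lemma quadratic_form_eqI:
  assumes "bounded_clinear S" "bounded_clinear R" "\<And>h. cinner (S h) h = cinner (R h) h"
  shows "S = R"
  using quadratic_form_eq_0[OF bounded_clinear_diff[OF assms(1,2)]]
  by (simp add: assms(3) cinner_simps fun_eq_iff)

text \<open>The defect \<open>d\<close> of selfadjointness is sesquilinear and vanishes on the
  diagonal, so the same polarisation kills it.\<close>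

lemma selfadjointI:
  assumes S: "bounded_clinear S" and real: "\<And>h. cinner (S h) h \<in> \<real>"
  shows "cinner (S x) y = cinner x (S y)"
proof -
  have r: "cinner (S h) h = cinner h (S h)" for h
    using real[of h] by (metis Reals_cnj_iff cinner_commute)
  define d where "d x y = cinner (S x) y - cinner x (S y)" for x y
  have a: "d h k + d k h = 0" for h k
    using r[of "h + k"] r[of h] r[of k]
    by (simp add: d_def cinner_simps bounded_clinear_simps[OF S] algebra_simps)
  have "d (\<i> *\<^sub>C x) y = \<i> * d x y" "d y (\<i> *\<^sub>C x) = - \<i> * d y x"
    by (simp_all add: d_def cinner_simps bounded_clinear_simps[OF S] algebra_simps)
  with a[of "\<i> *\<^sub>C x" y] a[of x y] have "d x y = 0"
    by (simp add: add_eq_0_iff2)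
  then show ?thesis by (simp add: d_def)
qed

lemma positive_op_selfadjoint:
  assumes "positive_op S" shows "cinner (S x) y = cinner x (S y)"
  using assms
  by (intro selfadjointI) (auto simp: positive_op_def elim: nonneg_Reals_cases)

lemma positive_op_Re_nonneg: "positive_op S \<Longrightarrow> 0 \<le> Re (cinner (S h) h)"
  by (auto simp: positive_op_def complex_nonneg_Reals_iff)

lemma positive_opI:
  assumes "bounded_clinear S" "\<And>x y. cinner (S x) y = cinner x (S y)" "\<And>h. 0 \<le> Re (cinner (S h) h)"
  shows "positive_op S"
  unfolding positive_op_def
proof (intro conjI allI assms)
  fix h
  have "Im (cinner (S h) h) = 0"
    using assms(2)[of h h] cinner_commute[of h "S h"] by (simp add: complex_eq_iff)
  then show "cinner (S h) h \<in> \<real>\<^sub>\<ge>\<^sub>0" using assms(3)[of h] by (simp add: complex_nonneg_Reals_iff)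
qed

text \<open>The Cauchy--Schwarz inequality for the form \<open>\<langle>S h, k\<rangle>\<close> at \<open>k = S h\<close>.\<close>

lemma positive_op_norm_square_le:
  assumes S: "positive_op S" and C: "\<And>h. Re (cinner (S h) h) \<le> C * (norm h)\<^sup>2"
  shows "(norm (S h))\<^sup>2 \<le> C * Re (cinner (S h) h)"
proof (cases "S h = 0")
  case False
  have lin: "bounded_clinear S" using S by (simp add: positive_op_def)
  let ?k = "S h" and ?a = "Re (cinner (S h) h)" and ?n = "(norm (S h))\<^sup>2"
  \<comment> \<open>Expanding yields a cross term \<open>- 2 * C * ?n\<close> and a last term that
    the hypothesis at \<open>?k\<close> bounds by \<open>C * ?n\<close>. Half of the cross term
    survives, and one factor \<open>C\<close> cancels.\<close>
  have pos: "0 \<le> Re (cinner (S (C *\<^sub>R h - ?k)) (C *\<^sub>R h - ?k))"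
    by (rule positive_op_Re_nonneg[OF S])
  have "cinner (S ?k) h = cinner ?k ?k" by (simp add: positive_op_selfadjoint[OF S])
  with pos have "0 \<le> C\<^sup>2 * ?a - 2 * C * ?n + Re (cinner (S ?k) ?k)"
    by (simp add: cinner_simps bounded_clinear_simps[OF lin] Re_cinner_self algebra_simps power2_eq_square)
  also have "\<dots> \<le> C\<^sup>2 * ?a - C * ?n" using C[of ?k] by simp
  finally have "0 \<le> C * (C * ?a - ?n)" by (simp add: power2_eq_square algebra_simps)
  moreover have "C > 0"
  proof (rule ccontr)
    assume "\<not> C > 0"
    then have "Re (cinner (S x) x) \<le> 0" for x
      using C[of x] mult_nonneg_nonneg[of "- C" "(norm x)\<^sup>2"] by simp
    then have "Re (cinner (S x) x) = 0" for x
      using positive_op_Re_nonneg[OF S, of x] by (simp add: order.antisym)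
    then have "cinner (S x) x = 0" for x
      using S by (simp add: positive_op_def complex_nonneg_Reals_iff complex_eq_iff)
    with quadratic_form_eq_0[OF lin] False show False by (metis)
  qed
  ultimately show ?thesis by (simp add: zero_le_mult_iff)
qed (use C[of h] in auto)

section \<open>Generating the bounded Borel functions by monotone limits\<close>

text \<open>Boundedness is asked on \<open>{0..M}\<close> only, so that powers qualify; the measures
  to be integrated against do not charge the rest of the line.\<close>

definition bdd_borel :: "real \<Rightarrow> (real \<Rightarrow> real) \<Rightarrow> bool"
  where "bdd_borel M f \<longleftrightarrow> f \<in> borel_measurable borel \<and> (\<exists>C. \<forall>x\<in>{0..M}. \<bar>f x\<bar> \<le> C)"

lemma bdd_borelI: "f \<in> borel_measurable borel \<Longrightarrow> (\<And>x. 0 \<le> x \<Longrightarrow> x \<le> M \<Longrightarrow> \<bar>f x\<bar> \<le> C) \<Longrightarrow> bdd_borel M f"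
  unfolding bdd_borel_def by (intro conjI exI[of _ C]) auto

lemma bdd_borel_measurable [measurable_dest]: "bdd_borel M f \<Longrightarrow> f \<in> borel_measurable borel"
  by (simp add: bdd_borel_def)

lemma bdd_borel_bound:
  assumes "bdd_borel M f"
  obtains C where "C \<ge> 0" "\<And>x. 0 \<le> x \<Longrightarrow> x \<le> M \<Longrightarrow> \<bar>f x\<bar> \<le> C"
proof -
  from assms obtain C where "\<forall>x\<in>{0..M}. \<bar>f x\<bar> \<le> C" by (auto simp: bdd_borel_def)
  then show ?thesis by (intro that[of "\<bar>C\<bar>"]) (auto intro: order_trans[OF _ abs_ge_self])
qed

lemma bdd_borel_add:
  assumes "bdd_borel M f" "bdd_borel M g" shows "bdd_borel M (\<lambda>x. f x + g x)"
proof -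
  obtain C where C: "\<And>x. 0 \<le> x \<Longrightarrow> x \<le> M \<Longrightarrow> \<bar>f x\<bar> \<le> C" by (blast intro: bdd_borel_bound[OF assms(1)])
  obtain D where D: "\<And>x. 0 \<le> x \<Longrightarrow> x \<le> M \<Longrightarrow> \<bar>g x\<bar> \<le> D" by (blast intro: bdd_borel_bound[OF assms(2)])
  show ?thesis
    by (rule bdd_borelI[where C = "C + D"])
      (use assms in \<open>auto simp: bdd_borel_def intro: order_trans[OF abs_triangle_ineq add_mono[OF C D]]\<close>)
qed

lemma bdd_borel_mult:
  assumes "bdd_borel M f" "bdd_borel M g" shows "bdd_borel M (\<lambda>x. f x * g x)"
proof -
  obtain C where C: "C \<ge> 0" "\<And>x. 0 \<le> x \<Longrightarrow> x \<le> M \<Longrightarrow> \<bar>f x\<bar> \<le> C" by (blast intro: bdd_borel_bound[OF assms(1)])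
  obtain D where D: "\<And>x. 0 \<le> x \<Longrightarrow> x \<le> M \<Longrightarrow> \<bar>g x\<bar> \<le> D" by (blast intro: bdd_borel_bound[OF assms(2)])
  show ?thesis
    by (rule bdd_borelI[where C = "C * D"])
      (use assms C(1) in \<open>auto simp: bdd_borel_def abs_mult intro!: mult_mono C(2) D\<close>)
qed

lemma bdd_borel_const: "bdd_borel M (\<lambda>_. c)"
  by (rule bdd_borelI[where C = "\<bar>c\<bar>"]) auto

lemma bdd_borel_indicator: "A \<in> sets borel \<Longrightarrow> bdd_borel M (indicator A)"
  by (rule bdd_borelI[where C = 1]) (auto simp: indicator_def)

lemma bdd_borel_continuous: "continuous_on UNIV f \<Longrightarrow> bdd_borel M f"
proof -
  assume f: "continuous_on UNIV f"
  then have "bounded (f ` {0..M})"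
    by (intro compact_imp_bounded compact_continuous_image) (auto intro: continuous_on_subset)
  with f show ?thesis
    by (auto simp: bdd_borel_def bounded_iff intro: borel_measurable_continuous_onI)
qed

lemma bdd_borel_power: "bdd_borel M (\<lambda>x. x ^ n)"
  by (intro bdd_borel_continuous continuous_intros)

lemma bdd_borel_diff: "bdd_borel M f \<Longrightarrow> bdd_borel M g \<Longrightarrow> bdd_borel M (\<lambda>x. f x - g x)"
  using bdd_borel_add[of M f "\<lambda>x. - 1 * g x"] bdd_borel_mult[of M "\<lambda>_. -1" g] by (simp add: bdd_borel_const)

text \<open>Hypotheses of a functional monotone class theorem. Convergence is tested on
  \<open>{0..M}\<close> only, so membership of a \<open>bdd_borel\<close> function does not depend
  on its values elsewhere. Decreasing limits are covered through the scalar -1.\<close>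

definition mono_closed :: "real \<Rightarrow> (real \<Rightarrow> real) set \<Rightarrow> bool"
  where "mono_closed M \<C> \<longleftrightarrow>
    (\<forall>f\<in>\<C>. \<forall>g\<in>\<C>. (\<lambda>x. f x + g x) \<in> \<C>) \<and>
    (\<forall>c. \<forall>f\<in>\<C>. (\<lambda>x. c * f x) \<in> \<C>) \<and>
    (\<forall>f g. (\<forall>n::nat. f n \<in> \<C>) \<longrightarrow> bdd_borel M g \<longrightarrow>
      (\<forall>x\<in>{0..M}. incseq (\<lambda>n. f n x) \<and> (\<lambda>n. f n x) \<longlonglongrightarrow> g x) \<longrightarrow> g \<in> \<C>)"

lemma mono_closedD:
  assumes "mono_closed M \<C>"
  shows "f \<in> \<C> \<Longrightarrow> g \<in> \<C> \<Longrightarrow> (\<lambda>x. f x + g x) \<in> \<C>"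
    and "f \<in> \<C> \<Longrightarrow> (\<lambda>x. c * f x) \<in> \<C>"
    and "(\<And>n::nat. F n \<in> \<C>) \<Longrightarrow> bdd_borel M g \<Longrightarrow>
      (\<And>x. 0 \<le> x \<Longrightarrow> x \<le> M \<Longrightarrow> incseq (\<lambda>n. F n x)) \<Longrightarrow>
      (\<And>x. 0 \<le> x \<Longrightarrow> x \<le> M \<Longrightarrow> (\<lambda>n. F n x) \<longlonglongrightarrow> g x) \<Longrightarrow> g \<in> \<C>"
proof -
  assume *: "\<And>n. F n \<in> \<C>" "bdd_borel M g" "\<And>x. 0 \<le> x \<Longrightarrow> x \<le> M \<Longrightarrow> incseq (\<lambda>n. F n x)"
    "\<And>x. 0 \<le> x \<Longrightarrow> x \<le> M \<Longrightarrow> (\<lambda>n. F n x) \<longlonglongrightarrow> g x"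
  from assms have "(\<forall>n. F n \<in> \<C>) \<longrightarrow> bdd_borel M g \<longrightarrow>
      (\<forall>x\<in>{0..M}. incseq (\<lambda>n. F n x) \<and> (\<lambda>n. F n x) \<longlonglongrightarrow> g x) \<longrightarrow> g \<in> \<C>"
    unfolding mono_closed_def by (elim conjE allE)
  with * show "g \<in> \<C>" by simp
qed (use assms in \<open>simp_all add: mono_closed_def\<close>)

lemma mono_closed_cong:
  assumes "mono_closed M \<C>" "f \<in> \<C>" "bdd_borel M g" "\<And>x. 0 \<le> x \<Longrightarrow> x \<le> M \<Longrightarrow> f x = g x"
  shows "g \<in> \<C>"
  by (rule mono_closedD(3)[OF assms(1), of "\<lambda>_. f"]) (use assms in \<open>auto simp: incseq_def\<close>)

lemma mono_closed_sum:
  assumes C: "mono_closed M \<C>" and I: "finite I" "I \<noteq> {}" and f: "\<And>i. i \<in> I \<Longrightarrow> f i \<in> \<C>"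
  shows "(\<lambda>x. \<Sum>i\<in>I. f i x) \<in> \<C>"
  using I f by (induction rule: finite_ne_induct) (auto intro: mono_closedD(1,2)[OF C])

lemma mono_closed_bdd_borel_if_indicators:
  assumes C: "mono_closed M \<C>" and ind: "\<And>A. A \<in> sets borel \<Longrightarrow> indicator A \<in> \<C>"
    and f: "bdd_borel M f"
  shows "f \<in> \<C>"
proof -
  \<comment> \<open>The induction rule does not keep its functions bounded. Boundedness is therefore
    a premise inside the induction claim, inherited by nonnegative summands and approximants from
    the function that they build.\<close>
  have nonneg: "bdd_borel M u \<longrightarrow> u \<in> \<C>" if "u \<in> borel_measurable borel" "\<And>x. 0 \<le> u x" for u
    using that
  proof (induct rule: borel_measurable_induct_real)
    case (mult u c)
    show ?case
    proof (cases "c = 0")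
      \<comment> \<open>Boundedness of \<open>0 * u\<close> says nothing about \<open>u\<close>, so
        the induction hypothesis is out of reach; the zero function is obtained from an indicator
        instead.\<close>
      case True
      then show ?thesis using mono_closedD(2)[OF C ind[of UNIV], of 0] by simp
    next
      case False
      show ?thesis
      proof
        assume "bdd_borel M (\<lambda>x. c * u x)"
        then have "bdd_borel M (\<lambda>x. (1 / c) * (c * u x))"
          by (rule bdd_borel_mult[OF bdd_borel_const])
        moreover have "(\<lambda>x. (1 / c) * (c * u x)) = u" using False by (simp add: fun_eq_iff)
        ultimately have "bdd_borel M u" by (simp only:)
        with mult show "(\<lambda>x. c * u x) \<in> \<C>" by (simp add: mono_closedD(1,2)[OF C])
      qed
    qed
  next
    case (add u v)
    show ?case
    proof
      assume vu: "bdd_borel M (\<lambda>x. v x + u x)"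
      obtain K where K: "\<And>x. 0 \<le> x \<Longrightarrow> x \<le> M \<Longrightarrow> \<bar>v x + u x\<bar> \<le> K"
        by (blast intro: bdd_borel_bound[OF vu])
      have "bdd_borel M u" "bdd_borel M v"
        using add(1,2,4,5) by (auto intro!: bdd_borelI[where C = K] order_trans[OF _ K])
      with add show "(\<lambda>x. v x + u x) \<in> \<C>" by (simp add: mono_closedD(1,2)[OF C])
    qed
  next
    case (seq U)
    note lim = seq(5)
    show ?case
    proof
      assume u: "bdd_borel M u"
      obtain K where K: "\<And>x. 0 \<le> x \<Longrightarrow> x \<le> M \<Longrightarrow> \<bar>u x\<bar> \<le> K"
        by (blast intro: bdd_borel_bound[OF u])
      have inc: "incseq (\<lambda>i. U i x)" for x
        using seq(4) by (auto simp: incseq_def le_fun_def)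
      have "U i x \<le> u x" for i x
        using incseq_le[OF inc lim] by simp
      then have "bdd_borel M (U i)" for i
        using seq(1,2) K by (intro bdd_borelI[where C = K]) (auto intro: order_trans[OF order_trans[OF _ abs_ge_self] K])
      with seq(3) inc lim show "u \<in> \<C>" by (intro mono_closedD(3)[OF C _ u, of U]) auto
    qed
  qed (simp add: ind)
  obtain K where K: "\<And>x. 0 \<le> x \<Longrightarrow> x \<le> M \<Longrightarrow> \<bar>f x\<bar> \<le> K" by (blast intro: bdd_borel_bound[OF f])
  \<comment> \<open>On \<open>{0..M}\<close> the truncation at 0 is inert; elsewhere it supplies the
    global nonnegativity that the induction demands.\<close>
  let ?u = "\<lambda>x. max 0 (f x + K)"
  have [measurable]: "f \<in> borel_measurable borel" using f by (simp add: bdd_borel_def)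
  have "bdd_borel M ?u"
  proof (rule bdd_borelI[where C = "2 * K"])
    show "\<bar>?u x\<bar> \<le> 2 * K" if "0 \<le> x" "x \<le> M" for x
      using K[OF that] by (simp add: abs_le_iff)
  qed simp
  with nonneg have "?u \<in> \<C>" by simp
  then have "(\<lambda>x. ?u x + (- K) * indicator UNIV x) \<in> \<C>"
    by (intro mono_closedD(1,2)[OF C] ind) auto
  then show ?thesis
  proof (rule mono_closed_cong[OF C _ f])
    show "?u x + - K * indicator UNIV x = f x" if "0 \<le> x" "x \<le> M" for x
      using K[OF that] by (simp add: abs_le_iff)
  qed
qed

text \<open>Stone-Weierstrass gives uniform approximation by polynomials, but the class admits only
  monotone limits, so the approximants must be made increasing.\<close>

lemma mono_closed_continuous_if_powers:
  assumes C: "mono_closed M \<C>" and pow: "\<And>n. (\<lambda>x. x ^ n) \<in> \<C>" and f: "continuous_on UNIV f"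
  shows "f \<in> \<C>"
proof -
  have poly: "p \<in> \<C>" if p: "real_polynomial_function p" for p :: "real \<Rightarrow> real"
  proof -
    obtain a n where "p = (\<lambda>x. \<Sum>i\<le>n. a i * x ^ i)"
      using p by (auto simp: real_polynomial_function_iff_sum)
    then show ?thesis by (auto intro!: mono_closed_sum[OF C] mono_closedD(2)[OF C] pow)
  qed
  let ?e = "\<lambda>n. (1 / 2 :: real) ^ n"
  have "\<exists>p. real_polynomial_function p \<and> (\<forall>x\<in>{0..M}. \<bar>f x - p x\<bar> < ?e n)" for n
  proof -
    have "continuous_on {0..M} f" using f by (rule continuous_on_subset) simp
    then obtain g where "real_polynomial_function g" "\<And>x. x \<in> {0..M} \<Longrightarrow> \<bar>f x - g x\<bar> < ?e n"
      by (rule Stone_Weierstrass_real_polynomial_function[OF compact_Icc, where e = "?e n"])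
        (auto intro: that)
    then show ?thesis by blast
  qed
  then obtain p where p: "\<And>n. real_polynomial_function (p n)"
    and e: "\<And>n x. 0 \<le> x \<Longrightarrow> x \<le> M \<Longrightarrow> \<bar>f x - p n x\<bar> < ?e n"
    by (metis atLeastAtMost_iff)
  text \<open>Subtracting \<open>3 / 2\<^sup>n\<close> makes the uniform approximation increasing.\<close>
  let ?q = "\<lambda>n x. p n x + (- 3 * ?e n) * x ^ 0"
  show ?thesis
  proof (rule mono_closedD(3)[OF C, of ?q])
    show "?q n \<in> \<C>" for n by (intro mono_closedD(1,2)[OF C] pow poly p)
    show "bdd_borel M f" by (rule bdd_borel_continuous[OF f])
    fix x assume x: "0 \<le> x" "x \<le> M"
    show "incseq (\<lambda>n. ?q n x)"
    proof (rule incseq_SucI)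
      fix n
      \<comment> \<open>The two approximation errors add up to less than
        \<open>?e n + ?e (Suc n)\<close>, that is \<open>3 / 2 * ?e n\<close>, which is exactly what
        the shift gains from \<open>n\<close> to \<open>Suc n\<close>.\<close>
      show "?q n x \<le> ?q (Suc n) x" using e[OF x, of n] e[OF x, of "Suc n"]
        by (simp add: abs_if split: if_splits)
    qed
    have e0: "(\<lambda>n. ?e n) \<longlonglongrightarrow> 0" by (simp add: LIMSEQ_realpow_zero)
    have "(\<lambda>n. p n x - f x) \<longlonglongrightarrow> 0"
      by (rule Lim_null_comparison[OF _ e0]) (use e[OF x] in \<open>auto simp: abs_minus_commute intro!: always_eventually less_imp_le\<close>)
    from tendsto_add[OF this tendsto_add[OF tendsto_const[of "f x"] tendsto_mult_right[OF e0, of "-3"]]]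
    show "(\<lambda>n. ?q n x) \<longlonglongrightarrow> f x" by (simp add: mult.commute)
  qed
qed

text \<open>Dynkin's theorem for half-lines. The class is not assumed closed under products, so only
  disjoint unions can be treated.\<close>

lemma mono_closed_indicator_if_powers:
  assumes C: "mono_closed M \<C>" and pow: "\<And>n. (\<lambda>x. x ^ n) \<in> \<C>" and A: "A \<in> sets borel"
  shows "indicator A \<in> \<C>"
proof -
  have "Int_stable (range (\<lambda>a::real. {..a}))" by (auto simp: Int_stable_def)
  moreover have "range (\<lambda>a::real. {..a}) \<subseteq> Pow UNIV" by simp
  moreover have "A \<in> sigma_sets UNIV (range (\<lambda>a::real. {..a}))"
    using A by (simp add: borel_eq_atMost)
  ultimately show ?thesis
  proof (induction rule: sigma_sets_induct_disjoint)
    case (basic A)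
    then obtain a where a: "A = {..a}" by auto
    \<comment> \<open>Continuous ramps decrease to the indicator of a closed half-line, so their
      negatives increase.\<close>
    let ?c = "\<lambda>n x. - max 0 (min 1 (1 - real n * (x - a)))"
    have c: "(\<lambda>n. ?c n x) \<longlonglongrightarrow> - indicator {..a} x" for x
    proof (cases "x \<le> a")
      case True
      then have "real n * (x - a) \<le> 0" for n by (simp add: mult_nonneg_nonpos)
      then have "?c n x = -1" for n by (smt (verit))
      with True show ?thesis by simp
    next
      case False
      obtain N where N: "real N * (x - a) > 1" using False reals_Archimedean3[of "x - a"] by auto
      have "?c n x = 0" if "n \<ge> N" for n
      proof -
        have "real n * (x - a) \<ge> real N * (x - a)" using that False by (intro mult_right_mono) auto
        with N show ?thesis by simp
      qed
      then have "eventually (\<lambda>n. ?c n x = 0) sequentially" by (auto simp: eventually_sequentially)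
      with False show ?thesis by (simp add: tendsto_eventually)
    qed
    have "(\<lambda>x. - indicator {..a} x) \<in> \<C>"
    proof (rule mono_closedD(3)[OF C, of ?c])
      show "?c n \<in> \<C>" for n
        by (intro mono_closed_continuous_if_powers[OF C pow] continuous_intros)
      show "bdd_borel M (\<lambda>x. - indicator {..a} x)"
        by (rule bdd_borelI[where C = 1]) (auto simp: indicator_def)
      show "incseq (\<lambda>n. ?c n x)" for x
      proof (rule incseq_SucI)
        fix n
        show "?c n x \<le> ?c (Suc n) x"
        proof (cases "x \<le> a")
          case True
          then have "real n * (x - a) \<le> 0" "real (Suc n) * (x - a) \<le> 0"
            by (auto intro!: mult_nonneg_nonpos)
          then show ?thesis by simp
        qed (simp add: algebra_simps)
      qed
    qed (rule c)
    from mono_closedD(2)[OF C this, of "-1"] a show ?case by simp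
  next
    case empty
    then show ?case using mono_closedD(2)[OF C pow, of 0 0] by simp
  next
    case (compl A)
    have "(\<lambda>x. x ^ 0 + (- 1) * indicator A x) \<in> \<C>"
      by (intro mono_closedD(1,2)[OF C] pow compl)
    moreover have "(\<lambda>x. x ^ 0 + (- 1) * indicator A x) = (indicator (UNIV - A) :: real \<Rightarrow> real)"
      by (auto simp: fun_eq_iff indicator_def)
    ultimately show ?case by (simp only:)
  next
    case (union A)
    then have A: "A i \<in> sets borel" for i by (auto simp: borel_eq_atMost)
    have ind: "indicator (\<Union>i<n. A i) = (\<lambda>x. \<Sum>i<n. indicator (A i) x :: real)" for n
      using indicator_UN_disjoint[of "{..<n}" A] union(1)
      by (auto simp: fun_eq_iff disjoint_family_on_def)
    show ?case
    proof (rule mono_closedD(3)[OF C, of "\<lambda>n. indicator (\<Union>i<Suc n. A i)"])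
      show "indicator (\<Union>i<Suc n. A i) \<in> \<C>" for n
        unfolding ind by (rule mono_closed_sum[OF C]) (use union in auto)
      show "bdd_borel M (indicator (\<Union>i. A i))" using A by (intro bdd_borel_indicator) auto
      show "incseq (\<lambda>n. indicator (\<Union>i<Suc n. A i) x :: real)" for x
        by (auto simp: incseq_def indicator_def less_Suc_eq_le intro: order_trans)
      show "(\<lambda>n. indicator (\<Union>i<Suc n. A i) x :: real) \<longlonglongrightarrow> indicator (\<Union>i. A i) x" for x
        using LIMSEQ_Suc[OF LIMSEQ_indicator_UN] .
    qed
  qed
qed

text \<open>Allows two starting points for one extension argument: powers when an operator is given,
  indicators when an operator-valued measure is given.\<close>

definition generates_bdd_borel :: "real \<Rightarrow> (real \<Rightarrow> real) set \<Rightarrow> bool"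
  where "generates_bdd_borel M \<G> \<longleftrightarrow> (\<forall>\<C>. mono_closed M \<C> \<longrightarrow> \<G> \<subseteq> \<C> \<longrightarrow> {f. bdd_borel M f} \<subseteq> \<C>)"

lemma generates_bdd_borelD:
  "generates_bdd_borel M \<G> \<Longrightarrow> mono_closed M \<C> \<Longrightarrow> (\<And>g. g \<in> \<G> \<Longrightarrow> g \<in> \<C>) \<Longrightarrow> bdd_borel M f \<Longrightarrow> f \<in> \<C>"
  by (auto simp: generates_bdd_borel_def)

lemma generates_bdd_borel_indicators: "generates_bdd_borel M (indicator ` sets borel)"
  unfolding generates_bdd_borel_def
proof (intro allI impI subsetI)
  fix \<C> f assume "mono_closed M \<C>" "indicator ` sets borel \<subseteq> \<C>" "f \<in> {f. bdd_borel M f}"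
  then show "f \<in> \<C>" by (auto intro: mono_closed_bdd_borel_if_indicators[of M])
qed

lemma generates_bdd_borel_powers: "generates_bdd_borel M (range (\<lambda>n x. x ^ n))"
  unfolding generates_bdd_borel_def
proof (intro allI impI subsetI)
  fix \<C> :: "(real \<Rightarrow> real) set" and f
  assume C: "mono_closed M \<C>" and "range (\<lambda>n x. x ^ n) \<subseteq> \<C>" and f: "f \<in> {f. bdd_borel M f}"
  then have "(\<lambda>x. x ^ n) \<in> \<C>" for n by auto
  from mono_closed_bdd_borel_if_indicators[OF C mono_closed_indicator_if_powers[OF C this]] f
  show "f \<in> \<C>" by simp
qed

section \<open>Operators represented by families of scalar measures\<close>

lemma norm_scaleC:
  fixes x :: "'a::complex_inner"
  shows "norm (a *\<^sub>C x) = cmod a * norm x"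
proof -
  have "cinner (a *\<^sub>C x) (a *\<^sub>C x) = (a * cnj a) * cinner x x" by (simp add: cinner_simps)
  also have "\<dots> = of_real ((cmod a * norm x)\<^sup>2)"
    by (simp only: cinner_self power_mult_distrib of_real_mult flip: complex_norm_square)
  finally have "Re (cinner (a *\<^sub>C x) (a *\<^sub>C x)) = (cmod a * norm x)\<^sup>2" by simp
  then show ?thesis by (simp add: Re_cinner_self power2_eq_iff_nonneg)
qed

lemma abs_Re_cinner_le_norm: "\<bar>Re (cinner x y)\<bar> \<le> norm x * norm y"
  using Re_cinner_le_norm[of x y] Re_cinner_le_norm[of "- x" y] by (simp add: cinner_minus_left)

lemma bounded_linear_cinner_left: "bounded_linear (\<lambda>x. cinner x y)"
proof (rule bounded_linear_intro[where K = "2 * norm y"])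
  fix x
  have "Im (cinner x y) = Re (cinner ((- \<i>) *\<^sub>C x) y)" by (simp add: cinner_simps)
  then have "\<bar>Im (cinner x y)\<bar> \<le> norm x * norm y"
    using abs_Re_cinner_le_norm[of "(- \<i>) *\<^sub>C x" y] by (simp add: norm_scaleC)
  then show "norm (cinner x y) \<le> norm x * (2 * norm y)"
    using abs_Re_cinner_le_norm[of x y] cmod_le[of "cinner x y"] by simp
qed (simp_all add: cinner_simps scaleR_conv_of_real)

lemmas tendsto_cinner_left = bounded_linear.tendsto[OF bounded_linear_cinner_left]

lemma cinner_eqI: "(\<And>y. cinner x y = cinner x' y) \<Longrightarrow> x = x'"
  using cinner_self[of "x - x'"] by (simp add: cinner_diff_left)

text \<open>Each increment \<open>S n - S m\<close> is a positive operator whose form is at most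
  \<open>C\<close> times the squared norm, so \<open>positive_op_norm_square_le\<close> controls its
  values by increments of the convergent scalar sequence \<open>q n h\<close> (Vigier's
  theorem).\<close>

lemma monotone_operator_limit:
  fixes S :: "nat \<Rightarrow> 'a::chilbert_space \<Rightarrow> 'a"
  assumes S: "\<And>n. bounded_clinear (S n)" and q: "\<And>n h. cinner (S n h) h = of_real (q n h)"
    and inc: "\<And>h. incseq (\<lambda>n. q n h)" and bound: "\<And>n h. q n h \<le> q 0 h + C * (norm h)\<^sup>2"
    and C: "C \<ge> 0"
  obtains R where "bounded_clinear R" "\<And>h. (\<lambda>n. S n h) \<longlonglongrightarrow> R h"
proof -
  have diff: "(norm (S n h - S m h))\<^sup>2 \<le> C * (q n h - q m h)" if mn: "m \<le> n" for m n h
  proof -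
    let ?D = "\<lambda>h. S n h - S m h"
    have D: "cinner (?D k) k = of_real (q n k - q m k)" for k
      by (simp add: cinner_simps q)
    have le: "q m k \<le> q n k" "q 0 k \<le> q m k" for k
      using inc[of k] mn by (simp_all add: incseq_def)
    have "positive_op ?D"
      unfolding positive_op_def D using bounded_clinear_diff[OF S S] le by (simp del: of_real_diff)
    moreover have "Re (cinner (?D k) k) \<le> C * (norm k)\<^sup>2" for k
      unfolding D using bound[of n k] le[of k] by simp
    ultimately have "(norm (?D h))\<^sup>2 \<le> C * Re (cinner (?D h) h)"
      by (rule positive_op_norm_square_le)
    then show ?thesis by (simp add: D)
  qed
  define R where "R h = lim (\<lambda>n. S n h)" for h
  have R: "(\<lambda>n. S n h) \<longlonglongrightarrow> R h" for h
  proof -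
    have "convergent (\<lambda>n. q n h)"
      using incseq_convergent[OF inc, of h "q 0 h + C * (norm h)\<^sup>2"] bound[of _ h]
      unfolding convergent_def by blast
    then have "Cauchy (\<lambda>n. q n h)" by (rule convergent_Cauchy)
    have "Cauchy (\<lambda>n. S n h)"
    proof (rule CauchyI')
      fix e :: real assume "e > 0"
      \<comment> \<open>\<open>C + 1\<close> instead of \<open>C\<close>, which may be 0; it also
        makes the final estimate strict.\<close>
      then have "e\<^sup>2 / (C + 1) > 0" using C by simp
      from CauchyD[OF \<open>Cauchy (\<lambda>n. q n h)\<close> this]
      obtain N where N: "\<And>m n. m \<ge> N \<Longrightarrow> n \<ge> N \<Longrightarrow> norm (q n h - q m h) < e\<^sup>2 / (C + 1)"
        by blast
      have "dist (S m h) (S n h) < e" if "m \<ge> N" "n > m" for m n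
      proof -
        have "(norm (S n h - S m h))\<^sup>2 \<le> C * (q n h - q m h)" using diff that by simp
        also have "\<dots> \<le> C * (e\<^sup>2 / (C + 1))"
          using N[of m n] that C by (intro mult_left_mono) auto
        also have "\<dots> < (C + 1) * (e\<^sup>2 / (C + 1))"
          using \<open>e\<^sup>2 / (C + 1) > 0\<close> by (intro mult_strict_right_mono) auto
        also have "\<dots> = e\<^sup>2" using C by simp
        finally have "norm (S n h - S m h) < e"
          using \<open>e > 0\<close> by (metis less_imp_le power2_less_imp_less)
        then show ?thesis by (simp add: dist_norm norm_minus_commute)
      qed
      then show "\<exists>N. \<forall>m\<ge>N. \<forall>n>m. dist (S m h) (S n h) < e" by blast
    qed
    then show ?thesis by (simp add: R_def Cauchy_convergent convergent_LIMSEQ_iff[symmetric])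
  qed
  obtain K where K: "\<And>h. norm (S 0 h) \<le> K * norm h"
    by (blast intro: bounded_clinear_norm_bound[OF S[of 0]])
  have "bounded_clinear R"
  proof (rule bounded_clinearI[where K = "K + C"])
    show "R (x + y) = R x + R y" for x y
      by (rule LIMSEQ_unique[OF R]) (simp add: bounded_clinear_simps[OF S] tendsto_add R)
    show "norm (R h) \<le> norm h * (K + C)" for h
    proof (rule LIMSEQ_le_const2[OF tendsto_norm[OF R]], intro exI allI impI)
      fix n :: nat
      have "(norm (S n h - S 0 h))\<^sup>2 \<le> C * (q n h - q 0 h)" using diff by simp
      also have "\<dots> \<le> C * (C * (norm h)\<^sup>2)" using bound[of n h] C by (intro mult_left_mono) auto
      also have "\<dots> = (C * norm h)\<^sup>2" by (simp add: power2_eq_square)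
      finally have "norm (S n h - S 0 h) \<le> C * norm h"
        using C by (auto intro: power2_le_imp_le)
      then show "norm (S n h) \<le> norm h * (K + C)"
        using K[of h] norm_triangle_sub[of "S n h" "S 0 h"] by (simp add: algebra_simps)
    qed
    show "R (c *\<^sub>C x) = c *\<^sub>C R x" for c x
    proof (rule LIMSEQ_unique[OF R])
      have "bounded_linear (\<lambda>x :: 'a. c *\<^sub>C x)"
        by (rule bounded_linear_intro[where K = "cmod c"])
          (auto simp: scaleC_add_right scaleR_scaleC scaleC_scaleC mult.commute norm_scaleC)
      from bounded_linear.tendsto[OF this R[of x]]
      show "(\<lambda>n. S n (c *\<^sub>C x)) \<longlonglongrightarrow> c *\<^sub>C R x" by (simp add: bounded_clinear_simps[OF S])
    qed
  qed
  with R show ?thesis by (rule that[rotated])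
qed

section \<open>Finite measures carried by a bounded interval, and the operators that families of
  them represent\<close>

locale bdd_measure =
  fixes \<mu> :: "real measure" and M :: real
  assumes sets_mu [measurable_cong, simp]: "sets \<mu> = sets borel"
    and finite_mass: "emeasure \<mu> UNIV \<noteq> \<infinity>"
    and AE_supp: "AE x in \<mu>. 0 \<le> x \<and> x \<le> M"
begin

lemma space_mu [simp]: "space \<mu> = UNIV"
  using sets_eq_imp_space_eq[OF sets_mu] by simp

lemma finite_measure_mu: "finite_measure \<mu>"
  by (rule finite_measureI) (use finite_mass in simp)

lemma borel_measurable_mu: "bdd_borel M f \<Longrightarrow> f \<in> borel_measurable \<mu>"
  using bdd_borel_measurable by (simp cong: measurable_cong_sets)

lemma integrable_mu: "bdd_borel M f \<Longrightarrow> integrable \<mu> f"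
proof -
  assume f: "bdd_borel M f"
  obtain C where "\<And>x. 0 \<le> x \<Longrightarrow> x \<le> M \<Longrightarrow> \<bar>f x\<bar> \<le> C" by (blast intro: bdd_borel_bound[OF f])
  then have "AE x in \<mu>. norm (f x) \<le> C"
    by (intro eventually_mono[OF AE_supp]) auto
  then show ?thesis
    by (intro finite_measure.integrable_const_bound[OF finite_measure_mu] borel_measurable_mu f)
qed

lemma integral_mu_mono:
  assumes "bdd_borel M f" "bdd_borel M g" "\<And>x. 0 \<le> x \<Longrightarrow> x \<le> M \<Longrightarrow> f x \<le> g x"
  shows "integral\<^sup>L \<mu> f \<le> integral\<^sup>L \<mu> g"
  by (intro integral_mono_AE integrable_mu assms eventually_mono[OF AE_supp]) auto

lemma integral_mu_cong:
  assumes "bdd_borel M f" "bdd_borel M g" "\<And>x. 0 \<le> x \<Longrightarrow> x \<le> M \<Longrightarrow> f x = g x"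
  shows "integral\<^sup>L \<mu> f = integral\<^sup>L \<mu> g"
  by (intro antisym integral_mu_mono) (use assms in auto)

lemma integral_mu_tendsto:
  assumes f: "\<And>n. f n \<in> borel_measurable borel" and g: "bdd_borel M g"
    and W: "\<And>n x. 0 \<le> x \<Longrightarrow> x \<le> M \<Longrightarrow> \<bar>f n x\<bar> \<le> W"
    and lim: "\<And>x. 0 \<le> x \<Longrightarrow> x \<le> M \<Longrightarrow> (\<lambda>n. f n x) \<longlonglongrightarrow> g x"
  shows "(\<lambda>n. integral\<^sup>L \<mu> (f n)) \<longlonglongrightarrow> integral\<^sup>L \<mu> g"
proof (rule integral_dominated_convergence[where w = "\<lambda>_. W"])
  show "AE x in \<mu>. (\<lambda>n. f n x) \<longlonglongrightarrow> g x"
    using AE_supp by (rule eventually_mono) (use lim in auto)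
  show "AE x in \<mu>. norm (f n x) \<le> W" for n
    using AE_supp by (rule eventually_mono) (use W in auto)
  show "integrable \<mu> (\<lambda>_. W)" by (intro integrable_mu bdd_borel_const)
  show "f n \<in> borel_measurable \<mu>" for n using f by (simp cong: measurable_cong_sets)
qed (rule borel_measurable_mu[OF g])

text \<open>The weight \<open>k\<close> has no fixed sign, so monotone convergence does not apply to
  the products. Domination does: every \<open>f n\<close> lies between \<open>f 0\<close> and
  \<open>g\<close>.\<close>

lemma integral_mu_monotone_tendsto:
  assumes f: "\<And>n. bdd_borel M (f n)" and g: "bdd_borel M g" and k: "bdd_borel M k"
    and inc: "\<And>x. 0 \<le> x \<Longrightarrow> x \<le> M \<Longrightarrow> incseq (\<lambda>n. f n x)"
    and lim: "\<And>x. 0 \<le> x \<Longrightarrow> x \<le> M \<Longrightarrow> (\<lambda>n. f n x) \<longlonglongrightarrow> g x"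
  shows "(\<lambda>n. integral\<^sup>L \<mu> (\<lambda>x. f n x * k x)) \<longlonglongrightarrow> integral\<^sup>L \<mu> (\<lambda>x. g x * k x)"
proof -
  obtain C where C: "C \<ge> 0" "\<And>x. 0 \<le> x \<Longrightarrow> x \<le> M \<Longrightarrow> \<bar>f 0 x\<bar> \<le> C"
    by (blast intro: bdd_borel_bound[OF f])
  obtain D where D: "D \<ge> 0" "\<And>x. 0 \<le> x \<Longrightarrow> x \<le> M \<Longrightarrow> \<bar>g x\<bar> \<le> D"
    by (blast intro: bdd_borel_bound[OF g])
  obtain K where K: "\<And>x. 0 \<le> x \<Longrightarrow> x \<le> M \<Longrightarrow> \<bar>k x\<bar> \<le> K"
    by (blast intro: bdd_borel_bound[OF k])
  show ?thesis
  proof (rule integral_mu_tendsto[where W = "(C + D) * K"])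
    show "\<bar>f n x * k x\<bar> \<le> (C + D) * K" if x: "0 \<le> x" "x \<le> M" for n x
    proof -
      have "f 0 x \<le> f n x" "f n x \<le> g x"
        using inc[OF x] incseq_le[OF inc[OF x] lim[OF x], of n] by (auto simp: incseq_def)
      then have "\<bar>f n x\<bar> \<le> C + D"
        using C(2)[OF x] D(2)[OF x] C(1) D(1) by (simp add: abs_le_iff)
      then show ?thesis
        unfolding abs_mult using K[OF x] C(1) D(1) by (intro mult_mono) auto
    qed
    show "(\<lambda>n. f n x * k x) \<longlonglongrightarrow> g x * k x" if "0 \<le> x" "x \<le> M" for x
      by (intro tendsto_mult_right lim that)
  qed (use f[THEN bdd_borel_measurable] k[THEN bdd_borel_measurable] bdd_borel_mult[OF g k] in auto)
qed

end

text \<open>The scalar measures of a semispectral measure, seen without the operators. This covers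
  both a given \<open>F\<close> and the solutions of moment problems, for which no operator-valued
  measure is known yet.\<close>

locale form_family =
  fixes \<mu> :: "'a::chilbert_space \<Rightarrow> real measure" and M :: real
  assumes sets_family: "\<And>h. sets (\<mu> h) = sets borel"
    and mass: "\<And>h. emeasure (\<mu> h) UNIV = ennreal ((norm h)\<^sup>2)"
    and supp: "\<And>h. emeasure (\<mu> h) (- {0..M}) = 0"

sublocale form_family \<subseteq> bdd_measure "\<mu> h" M for h
proof
  have "space (\<mu> h) = UNIV" using sets_eq_imp_space_eq[OF sets_family] by simp
  then show "AE x in \<mu> h. 0 \<le> x \<and> x \<le> M"
    using sets_family by (intro AE_I[of _ _ "- {0..M}"]) (auto simp: supp)
qed (simp_all add: sets_family mass)

context form_family
begin

lemma measure_UNIV_mu: "measure (\<mu> h) UNIV = (norm h)\<^sup>2"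
  by (simp add: measure_def mass)

lemma integral_mu_const: "integral\<^sup>L (\<mu> h) (\<lambda>_. c) = c * (norm h)\<^sup>2"
  by (simp add: measure_UNIV_mu)

text \<open>The integral of \<open>f\<close> in the weak sense. Existence of \<open>S\<close> is a
  real question, because nothing in the locale makes the measures depend quadratically on
  \<open>h\<close>.\<close>

definition rep :: "(real \<Rightarrow> real) \<Rightarrow> ('a \<Rightarrow> 'a) \<Rightarrow> bool"
  where "rep f S \<longleftrightarrow> bounded_clinear S \<and> (\<forall>h. cinner (S h) h = of_real (integral\<^sup>L (\<mu> h) f))"

lemma repD: "rep f S \<Longrightarrow> bounded_clinear S" "rep f S \<Longrightarrow> cinner (S h) h = of_real (integral\<^sup>L (\<mu> h) f)"
  by (simp_all add: rep_def)

lemma rep_unique: "rep f S \<Longrightarrow> rep f R \<Longrightarrow> S = R"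
  by (rule quadratic_form_eqI) (simp_all add: rep_def)

lemma rep_selfadjoint: "rep f S \<Longrightarrow> cinner (S x) y = cinner x (S y)"
  by (rule selfadjointI) (simp_all add: rep_def)

lemma rep_one: "rep (\<lambda>_. 1) id"
  by (simp add: rep_def bounded_clinear_id measure_UNIV_mu cinner_self)

lemma rep_add:
  "bdd_borel M f \<Longrightarrow> bdd_borel M g \<Longrightarrow> rep f S \<Longrightarrow> rep g R \<Longrightarrow> rep (\<lambda>x. f x + g x) (\<lambda>h. S h + R h)"
  by (simp add: rep_def bounded_clinear_add cinner_simps integrable_mu)

lemma rep_scale: "rep f S \<Longrightarrow> rep (\<lambda>x. c * f x) (\<lambda>h. c *\<^sub>R S h)"
  by (simp add: rep_def bounded_clinear_scaleR cinner_simps)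

text \<open>Being represented by a real function, \<open>S \<circ> R\<close> is selfadjoint, while
  its adjoint is \<open>R \<circ> S\<close>.\<close>

lemma rep_comp_commute:
  assumes "rep f S" "rep g R" "rep k (S \<circ> R)" shows "S \<circ> R = R \<circ> S"
proof
  fix x
  have "cinner (S (R x)) y = cinner (R (S x)) y" for y
    using rep_selfadjoint[OF assms(3), of x y] by (simp add: rep_selfadjoint[OF assms(1)] rep_selfadjoint[OF assms(2)])
  then show "(S \<circ> R) x = (R \<circ> S) x" by (auto intro: cinner_eqI)
qed

text \<open>Convergence against every weight \<open>k\<close> is delivered together with the strong
  limit, because product formulas have to pass to the limit as well.\<close>

lemma rep_monotone_limit:
  assumes f: "\<And>n. bdd_borel M (f n)" and S: "\<And>n. rep (f n) (S n)" and g: "bdd_borel M g"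
    and inc: "\<And>x. 0 \<le> x \<Longrightarrow> x \<le> M \<Longrightarrow> incseq (\<lambda>n. f n x)"
    and lim: "\<And>x. 0 \<le> x \<Longrightarrow> x \<le> M \<Longrightarrow> (\<lambda>n. f n x) \<longlonglongrightarrow> g x"
  obtains R where "rep g R" "\<And>h. (\<lambda>n. S n h) \<longlonglongrightarrow> R h"
    "\<And>k h. bdd_borel M k \<Longrightarrow> (\<lambda>n. integral\<^sup>L (\<mu> h) (\<lambda>x. f n x * k x)) \<longlonglongrightarrow> integral\<^sup>L (\<mu> h) (\<lambda>x. g x * k x)"
proof -
  obtain C where C: "C \<ge> 0" "\<And>x. 0 \<le> x \<Longrightarrow> x \<le> M \<Longrightarrow> \<bar>f 0 x\<bar> \<le> C"
    by (blast intro: bdd_borel_bound[OF f])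
  obtain D where D: "D \<ge> 0" "\<And>x. 0 \<le> x \<Longrightarrow> x \<le> M \<Longrightarrow> \<bar>g x\<bar> \<le> D"
    by (blast intro: bdd_borel_bound[OF g])
  have le: "f n x \<le> g x" if "0 \<le> x" "x \<le> M" for n x
    by (rule incseq_le[OF inc[OF that] lim[OF that]])
  have conv: "(\<lambda>n. integral\<^sup>L (\<mu> h) (\<lambda>x. f n x * k x)) \<longlonglongrightarrow> integral\<^sup>L (\<mu> h) (\<lambda>x. g x * k x)"
    if "bdd_borel M k" for k h
    by (rule integral_mu_monotone_tendsto[OF f g that inc lim])
  obtain R where R: "bounded_clinear R" "\<And>h. (\<lambda>n. S n h) \<longlonglongrightarrow> R h"
  proof (rule monotone_operator_limit[of S "\<lambda>n h. integral\<^sup>L (\<mu> h) (f n)" "C + D"])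
    show "bounded_clinear (S n)" "cinner (S n h) h = of_real (integral\<^sup>L (\<mu> h) (f n))" for n h
      using repD[OF S] by auto
    show "incseq (\<lambda>n. integral\<^sup>L (\<mu> h) (f n))" for h
      by (intro incseq_SucI integral_mu_mono f) (use inc in \<open>auto simp: incseq_Suc_iff\<close>)
    show "integral\<^sup>L (\<mu> h) (f n) \<le> integral\<^sup>L (\<mu> h) (f 0) + (C + D) * (norm h)\<^sup>2" for n h
    proof -
      have "integral\<^sup>L (\<mu> h) (f n) \<le> integral\<^sup>L (\<mu> h) (\<lambda>x. f 0 x + (C + D))"
      proof (intro integral_mu_mono f bdd_borel_add bdd_borel_const)
        show "f n x \<le> f 0 x + (C + D)" if "0 \<le> x" "x \<le> M" for x
          using le[OF that, of n] C(2)[OF that] D(2)[OF that] by (simp add: abs_le_iff)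
      qed
      also have "\<dots> = integral\<^sup>L (\<mu> h) (f 0) + (C + D) * (norm h)\<^sup>2"
        by (subst Bochner_Integration.integral_add) (auto simp: integrable_mu f bdd_borel_const measure_UNIV_mu)
      finally show ?thesis .
    qed
  qed (use C D in auto)
  have "cinner (R h) h = of_real (integral\<^sup>L (\<mu> h) g)" for h
  proof (rule LIMSEQ_unique[OF tendsto_cinner_left[OF R(2)]])
    show "(\<lambda>n. cinner (S n h) h) \<longlonglongrightarrow> of_real (integral\<^sup>L (\<mu> h) g)"
      using conv[OF bdd_borel_const[of _ 1], of h] by (simp add: repD(2)[OF S] tendsto_of_real)
  qed
  with R(1) have "rep g R" by (simp add: rep_def)
  then show ?thesis by (rule that[OF _ R(2) conv])
qed

text \<open>With the right factor fixed, the strong limit of \<open>S n\<close> can be evaluated at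
  \<open>R h\<close>, so the product formula survives. Both representations share one
  \<open>S\<close>, which \<open>rep_unique\<close> identifies with any given one. The choice
  \<open>g = 1\<close>, \<open>R = id\<close> yields plain existence.\<close>

lemma mono_closed_rep:
  assumes g: "bdd_borel M g" and R: "bounded_clinear R"
  shows "mono_closed M {f. bdd_borel M f \<and> (\<exists>S. rep f S \<and> rep (\<lambda>x. f x * g x) (S \<circ> R))}"
    (is "mono_closed M ?C")
  unfolding mono_closed_def
proof (intro conjI ballI allI impI)
  fix f k assume "f \<in> ?C" "k \<in> ?C"
  then obtain S S' where fS: "bdd_borel M f" "rep f S" "rep (\<lambda>x. f x * g x) (S \<circ> R)"
    and kS: "bdd_borel M k" "rep k S'" "rep (\<lambda>x. k x * g x) (S' \<circ> R)" by auto
  let ?S = "\<lambda>h. S h + S' h"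
  have "rep (\<lambda>x. f x * g x + k x * g x) (\<lambda>h. (S \<circ> R) h + (S' \<circ> R) h)"
    using fS kS g by (intro rep_add bdd_borel_mult)
  then have "rep (\<lambda>x. (f x + k x) * g x) (?S \<circ> R)"
    by (simp add: o_def distrib_right)
  moreover have "rep (\<lambda>x. f x + k x) ?S" using fS kS by (intro rep_add)
  ultimately show "(\<lambda>x. f x + k x) \<in> ?C" using fS(1) kS(1) by (blast intro: bdd_borel_add)
next
  fix c f assume "f \<in> ?C"
  then obtain S where fS: "bdd_borel M f" "rep f S" "rep (\<lambda>x. f x * g x) (S \<circ> R)" by auto
  let ?S = "\<lambda>h. c *\<^sub>R S h"
  have "rep (\<lambda>x. (c * f x) * g x) (?S \<circ> R)"
    using rep_scale[OF fS(3), of c] by (simp add: o_def mult.assoc)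
  moreover have "rep (\<lambda>x. c * f x) ?S" using fS by (intro rep_scale)
  ultimately show "(\<lambda>x. c * f x) \<in> ?C" using bdd_borel_mult[OF bdd_borel_const fS(1)] by blast
next
  fix f k assume f: "\<forall>n::nat. f n \<in> ?C" and k: "bdd_borel M k"
    and lim: "\<forall>x\<in>{0..M}. incseq (\<lambda>n. f n x) \<and> (\<lambda>n. f n x) \<longlonglongrightarrow> k x"
  from f obtain S where S: "\<And>n. bdd_borel M (f n)" "\<And>n. rep (f n) (S n)"
    "\<And>n. rep (\<lambda>x. f n x * g x) (S n \<circ> R)" by simp metis
  obtain S' where S': "rep k S'" "\<And>h. (\<lambda>n. S n h) \<longlonglongrightarrow> S' h"
    "\<And>h. (\<lambda>n. integral\<^sup>L (\<mu> h) (\<lambda>x. f n x * g x)) \<longlonglongrightarrow> integral\<^sup>L (\<mu> h) (\<lambda>x. k x * g x)"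
    by (rule rep_monotone_limit[OF S(1,2) k, of "\<lambda>n. n"]) (use lim g in auto)
  have "cinner ((S' \<circ> R) h) h = of_real (integral\<^sup>L (\<mu> h) (\<lambda>x. k x * g x))" for h
    unfolding o_def
  proof (rule LIMSEQ_unique[OF tendsto_cinner_left[OF S'(2)]])
    show "(\<lambda>n. cinner (S n (R h)) h) \<longlonglongrightarrow> of_real (integral\<^sup>L (\<mu> h) (\<lambda>x. k x * g x))"
      using S'(3)[of h] repD(2)[OF S(3), of _ h] by (simp add: tendsto_of_real)
  qed
  with S'(1) R have "rep (\<lambda>x. k x * g x) (S' \<circ> R)" by (auto simp: rep_def intro: bounded_clinear_comp)
  with S'(1) k show "k \<in> ?C" by blast
qed

text \<open>Multiplicativity is extended in one factor at a time. In between, the factors are swapped: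
  the product of two selfadjoint operators is selfadjoint only if they commute.\<close>

lemma rep_multiplicative:
  assumes gen: "generates_bdd_borel M (g ` I)"
    and g: "\<And>i. i \<in> I \<Longrightarrow> bdd_borel M (g i)" "\<And>i. i \<in> I \<Longrightarrow> rep (g i) (G i)"
    and mult: "\<And>i j. i \<in> I \<Longrightarrow> j \<in> I \<Longrightarrow> rep (\<lambda>x. g i x * g j x) (G i \<circ> G j)"
  shows "bdd_borel M f \<Longrightarrow> \<exists>S. rep f S"
    and "bdd_borel M f \<Longrightarrow> bdd_borel M k \<Longrightarrow> rep f S \<Longrightarrow> rep k R \<Longrightarrow> rep (\<lambda>x. f x * k x) (S \<circ> R)"
proof -
  have *: "rep (\<lambda>x. f x * k x) (S \<circ> R)"
    if k: "bdd_borel M k" "rep k R" and f: "bdd_borel M f" "rep f S"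
      and kg: "\<And>i. i \<in> I \<Longrightarrow> rep (\<lambda>x. g i x * k x) (G i \<circ> R)" for f k S R
  proof -
    have "f \<in> {f. bdd_borel M f \<and> (\<exists>S. rep f S \<and> rep (\<lambda>x. f x * k x) (S \<circ> R))}"
      by (rule generates_bdd_borelD[OF gen mono_closed_rep[OF k(1) repD(1)[OF k(2)]] _ f(1)]) (use g kg in blast)
    then show ?thesis using rep_unique[OF f(2)] by auto
  qed
  have gk: "rep (\<lambda>x. g i x * k x) (G i \<circ> R)" if k: "bdd_borel M k" "rep k R" and i: "i \<in> I" for k R i
  proof -
    have "rep (\<lambda>x. k x * g i x) (R \<circ> G i)" by (rule *[OF g[OF i] k mult[OF _ i]])
    then show ?thesis
      using rep_comp_commute[OF k(2) g(2)[OF i]] by (simp add: mult.commute)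
  qed
  show "bdd_borel M f \<Longrightarrow> bdd_borel M k \<Longrightarrow> rep f S \<Longrightarrow> rep k R \<Longrightarrow> rep (\<lambda>x. f x * k x) (S \<circ> R)"
    by (rule *[OF _ _ _ _ gk])
  show "\<exists>S. rep f S" if f: "bdd_borel M f"
  proof -
    have "f \<in> {f. bdd_borel M f \<and> (\<exists>S. rep f S \<and> rep (\<lambda>x. f x * 1) (S \<circ> id))}"
      by (rule generates_bdd_borelD[OF gen mono_closed_rep[OF bdd_borel_const bounded_clinear_id] _ f]) (use g in auto)
    then show ?thesis by auto
  qed
qed

end

section \<open>Hausdorff's moment problem\<close>

text \<open>Pascal's rule, arranged so that the recursion of Hausdorff weights can be applied to
  each bracket.\<close>

lemma sum_choose_Suc:
  fixes f :: "nat \<Rightarrow> real"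
  shows "(\<Sum>j\<le>Suc N. real (Suc N choose j) * f j) = (\<Sum>j\<le>N. real (N choose j) * (f j + f (Suc j)))"
proof -
  have "(\<Sum>j\<le>Suc N. real (Suc N choose j) * f j)
      = f 0 + (\<Sum>j\<le>N. real (N choose j) * f (Suc j) + real (N choose Suc j) * f (Suc j))"
    by (subst sum.atMost_Suc_shift) (simp add: algebra_simps)
  also have "\<dots> = (\<Sum>j\<le>N. real (N choose j) * f (Suc j)) + (\<Sum>j\<le>Suc N. real (N choose j) * f j)"
    by (simp add: sum.atMost_Suc_shift[of "\<lambda>j. real (N choose j) * f j"] sum.distrib del: sum.atMost_Suc)
  finally show ?thesis by (simp add: sum.distrib distrib_left)
qed

text \<open>The factors differ by \<open>(1 - k / n) * i / (n - i)\<close> in absolute value, and a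
  difference of products is at most the sum of these. For that all factors must lie between -1 and
  1; \<open>2 * m \<le> n\<close> ensures it even where \<open>k < i\<close>.\<close>

lemma abs_prod_falling_diff_power_le:
  assumes "k \<le> n" "2 * m \<le> n" "0 < n"
  shows "\<bar>(\<Prod>i<m. (real k - real i) / (real n - real i)) - (real k / real n) ^ m\<bar> \<le> real m * (real m / (real n - real m))"
proof -
  have "\<bar>(\<Prod>i<m. (real k - real i) / (real n - real i)) - (\<Prod>i<m. real k / real n)\<bar>
      \<le> (\<Sum>i<m. \<bar>(real k - real i) / (real n - real i) - real k / real n\<bar>)"
    by (rule norm_prod_diff[where 'a = real, simplified]) (use assms in \<open>auto simp: abs_le_iff field_simps\<close>)
  also have "\<dots> \<le> (\<Sum>i<m. real m / (real n - real m))"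
  proof (rule sum_mono)
    fix i assume "i \<in> {..<m}"
    then have i: "real i < real m" "2 * real m \<le> real n" "real k \<le> real n" "0 < real n"
      using assms of_nat_mono[OF assms(2), where 'a = real] by auto
    have "\<bar>(real k - real i) / (real n - real i) - real k / real n\<bar>
        = \<bar>(real k - real n) / real n * (real i / (real n - real i))\<bar>"
      using i by (intro arg_cong[of _ _ abs]) (simp add: field_simps)
    also have "\<dots> \<le> 1 * (real i / (real n - real i))"
      unfolding abs_mult using i by (intro mult_mono) (auto simp: field_simps)
    also have "\<dots> \<le> real m / (real n - real m)" using i by (simp add: frac_le)
    finally show "\<bar>(real k - real i) / (real n - real i) - real k / real n\<bar> \<le> real m / (real n - real m)"
      by simp
  qed
  finally show ?thesis by simp
qed

text \<open>\<open>w k l\<close> stands for the integral of \<open>x ^ k * (1 - x) ^ l\<close> over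
  the unit interval, and \<open>rec\<close> for \<open>x + (1 - x) = 1\<close>.\<close>

locale hausdorff =
  fixes w :: "nat \<Rightarrow> nat \<Rightarrow> real"
  assumes nonneg: "\<And>k l. 0 \<le> w k l" and rec: "\<And>k l. w k l = w (Suc k) l + w k (Suc l)"
begin

text \<open>The would-be integral of a Bernstein polynomial, to be used as the mass of an atom at
  \<open>real k / real n\<close>.\<close>

definition p :: "nat \<Rightarrow> nat \<Rightarrow> real"
  where "p n k = real (n choose k) * w k (n - k)"

lemma p_nonneg: "0 \<le> p n k"
  by (simp add: p_def nonneg)

text \<open>The binomial expansion of \<open>(x + (1 - x)) ^ N\<close> multiplied by
  \<open>x ^ m\<close>, derived from \<open>rec\<close> alone.\<close>

lemma sum_choose_w: "(\<Sum>j\<le>N. real (N choose j) * w (m + j) (N - j)) = w m 0"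
proof -
  have "(\<Sum>j\<le>N. real (N choose j) * w (m + j) (l + (N - j))) = w m l" for l
  proof (induction N)
    case (Suc N)
    have "(\<Sum>j\<le>Suc N. real (Suc N choose j) * w (m + j) (l + (Suc N - j)))
        = (\<Sum>j\<le>N. real (N choose j) * w (m + j) (l + (N - j)))"
      unfolding sum_choose_Suc
    proof (rule sum.cong)
      fix j assume "j \<in> {..N}"
      then have "Suc N - j = Suc (N - j)" by auto
      then show "real (N choose j) * (w (m + j) (l + (Suc N - j)) + w (m + Suc j) (l + (Suc N - Suc j)))
          = real (N choose j) * w (m + j) (l + (N - j))"
        using rec[of "m + j" "l + (N - j)"] by simp
    qed simp
    then show ?case using Suc.IH by simp
  qed simp
  from this[of 0] show ?thesis by simp
qed

lemma sum_p: "(\<Sum>k\<le>n. p n k) = w 0 0"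
  using sum_choose_w[of n 0] by (simp add: p_def)

text \<open>Falling factorials in place of powers make the discrete moments exact: the product is a
  quotient of binomial coefficients that vanishes for \<open>k < m\<close>.\<close>

lemma sum_p_falling:
  assumes "m \<le> n"
  shows "(\<Sum>k\<le>n. p n k * (\<Prod>i<m. (real k - real i) / (real n - real i))) = w m 0"
proof -
  have ratio: "(\<Prod>i<m. (real k - real i) / (real n - real i)) = real (k choose m) / real (n choose m)" for k
    by (simp add: prod_dividef binomial_gbinomial gbinomial_prod_rev atLeast0LessThan)
  have n0: "real (n choose m) > 0" using assms by simp
  have "(\<Sum>k\<le>n. p n k * (real (k choose m) / real (n choose m)))
      = (\<Sum>k\<in>{m..n}. p n k * (real (k choose m) / real (n choose m)))"
    by (rule sum.mono_neutral_right) (auto simp: binomial_eq_0)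
  also have "\<dots> = (\<Sum>k\<in>{m..n}. real ((n - m) choose (k - m)) * w k (n - k))"
  proof (rule sum.cong)
    fix k assume "k \<in> {m..n}"
    then have "real (n choose k) * real (k choose m) = real (n choose m) * real ((n - m) choose (k - m))"
      using choose_mult[of m k n] by (simp flip: of_nat_mult)
    then show "p n k * (real (k choose m) / real (n choose m)) = real ((n - m) choose (k - m)) * w k (n - k)"
      using n0 by (simp add: p_def field_simps)
  qed simp
  also have "\<dots> = (\<Sum>j\<le>n - m. real ((n - m) choose j) * w (m + j) (n - m - j))"
    by (rule sum.reindex_bij_witness[of _ "\<lambda>j. m + j" "\<lambda>k. k - m"]) (use assms in auto)
  also have "\<dots> = w m 0" by (rule sum_choose_w)
  finally show ?thesis unfolding ratio .
qed

lemma sum_p_power_tendsto: "(\<lambda>n. \<Sum>k\<le>n. p n k * (real k / real n) ^ m) \<longlonglongrightarrow> w m 0"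
proof -
  have "(\<lambda>n. (\<Sum>k\<le>n. p n k * (real k / real n) ^ m) - w m 0) \<longlonglongrightarrow> 0"
  proof (rule Lim_null_comparison)
    show "\<forall>\<^sub>F n in sequentially. norm ((\<Sum>k\<le>n. p n k * (real k / real n) ^ m) - w m 0)
        \<le> w 0 0 * (real m * (real m / (real n - real m)))"
      using eventually_ge_at_top[of "2 * m + 1"]
    proof eventually_elim
      case (elim n)
      let ?r = "\<lambda>k. \<Prod>i<m. (real k - real i) / (real n - real i)"
      have "norm ((\<Sum>k\<le>n. p n k * (real k / real n) ^ m) - w m 0)
          = norm (\<Sum>k\<le>n. p n k * ((real k / real n) ^ m - ?r k))"
        using sum_p_falling[of m n] elim by (simp add: right_diff_distrib sum_subtractf)
      also have "\<dots> \<le> (\<Sum>k\<le>n. p n k * \<bar>(real k / real n) ^ m - ?r k\<bar>)"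
        by (rule order_trans[OF norm_sum]) (simp only: real_norm_def abs_mult abs_of_nonneg[OF p_nonneg] order_refl)
      also have "\<dots> \<le> (\<Sum>k\<le>n. p n k * (real m * (real m / (real n - real m))))"
      proof (rule sum_mono, rule mult_left_mono[OF _ p_nonneg])
        fix k assume "k \<in> {..n}"
        then have "\<bar>?r k - (real k / real n) ^ m\<bar> \<le> real m * (real m / (real n - real m))"
          using elim by (intro abs_prod_falling_diff_power_le) auto
        then show "\<bar>(real k / real n) ^ m - ?r k\<bar> \<le> real m * (real m / (real n - real m))"
          by (subst abs_minus_commute)
      qed
      also have "\<dots> = w 0 0 * (real m * (real m / (real n - real m)))"
        by (subst sum_distrib_right[symmetric]) (simp only: sum_p)
      finally show ?case .
    qed
    show "(\<lambda>n. w 0 0 * (real m * (real m / (real n - real m)))) \<longlonglongrightarrow> 0"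
      by real_asymp
  qed
  then show ?thesis by (simp add: LIM_zero_iff)
qed

text \<open>The discrete measures live on the unit interval, hence are tight. A weak limit of a
  subsequence has the limits of their moments as its moments.\<close>

lemma normalized_measure_exists:
  assumes one: "w 0 0 = 1"
  obtains \<nu> :: "real measure" where "prob_space \<nu>" "sets \<nu> = sets borel" "AE x in \<nu>. 0 \<le> x \<and> x \<le> 1"
    "\<And>n. integral\<^sup>L \<nu> (\<lambda>x. x ^ n) = w n 0"
proof -
  define \<mu> where "\<mu> n = distr (point_measure {..n} (\<lambda>k. ennreal (p n k))) borel (\<lambda>k. real k / real n)" for n
  have integral_\<mu>: "integral\<^sup>L (\<mu> n) f = (\<Sum>k\<le>n. p n k * f (real k / real n))"
    if "f \<in> borel_measurable borel" for f :: "real \<Rightarrow> real" and n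
    unfolding \<mu>_def using that
    by (subst integral_distr) (auto simp: lebesgue_integral_point_measure_finite p_nonneg)
  have emeasure_\<mu>: "emeasure (\<mu> n) A = 1" if "A \<in> sets borel" "{0..1} \<subseteq> A" for A n
  proof -
    have "(\<lambda>k. real k / real n) -` A \<inter> {..n} = {..n}"
    proof -
      \<comment> \<open>For \<open>n = 0\<close> the only atom is at \<open>0 / 0\<close>, which is
        0.\<close>
      have "real k / real n \<in> {0..1}" if "k \<le> n" for k
        using that by (cases "n = 0") (auto simp: field_simps)
      with that show ?thesis by blast
    qed
    moreover have "(\<Sum>k\<le>n. ennreal (p n k)) = 1"
      using sum_p[of n] one by (subst sum_ennreal) (auto simp: p_nonneg)
    ultimately show ?thesis
      unfolding \<mu>_def using that
      by (subst emeasure_distr) (auto simp: space_point_measure emeasure_point_measure_finite)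
  qed
  have real_distr: "real_distribution (\<mu> n)" for n
  proof -
    have "sets (\<mu> n) = sets borel" "space (\<mu> n) = UNIV" by (auto simp: \<mu>_def)
    then show ?thesis
      by (auto intro!: real_distribution.intro real_distribution_axioms.intro prob_spaceI emeasure_\<mu>)
  qed
  have "tight \<mu>"
    unfolding tight_def
  proof (intro conjI allI impI)
    fix \<epsilon> :: real assume "\<epsilon> > 0"
    \<comment> \<open>Tightness speaks of intervals open on the left, so the endpoint must be
      negative to capture the atom at 0.\<close>
    have "emeasure (\<mu> n) {-1<..1} = 1" for n by (rule emeasure_\<mu>) auto
    then have "(- 1 :: real) < 1 \<and> (\<forall>n. 1 - \<epsilon> < measure (\<mu> n) {-1<..1})"
      using \<open>\<epsilon> > 0\<close> by (simp add: measure_def)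
    then show "\<exists>a b. a < b \<and> (\<forall>n. 1 - \<epsilon> < measure (\<mu> n) {a<..b})" by blast
  qed (rule real_distr)
  from tight_imp_convergent_subsubsequence[OF this strict_mono_id]
  obtain r \<nu> where r: "strict_mono r" and \<nu>: "real_distribution \<nu>" and conv: "weak_conv_m (\<mu> \<circ> id \<circ> r) \<nu>"
    by blast
  interpret real_distribution \<nu> by (rule \<nu>)
  have sets_\<nu>: "sets \<nu> = sets borel" by simp
  have lim: "(\<lambda>n. integral\<^sup>L (\<mu> (r n)) f) \<longlonglongrightarrow> integral\<^sup>L \<nu> f"
    if "continuous_on UNIV f" "\<And>x. \<bar>f x\<bar> \<le> 1" for f :: "real \<Rightarrow> real"
    using weak_conv_imp_integral_bdd_continuous_conv[OF _ \<nu> conv, of f 1] real_distr that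
    by (simp add: continuous_on_eq_continuous_at)
  \<comment> \<open>Powers are unbounded on the line; composed with this clamp they become bounded
    and continuous, as weak convergence requires.\<close>
  define c where "c x = max 0 (min 1 x)" for x :: real
  have c: "continuous_on UNIV c" "\<And>x. 0 \<le> c x" "\<And>x. c x \<le> 1"
    by (auto simp: c_def[abs_def] intro!: continuous_intros)
  have c_id: "c (real k / real n) = real k / real n" if "k \<le> n" for k n
    using that by (cases "n = 0") (auto simp: c_def field_simps)
  have [measurable]: "c \<in> borel_measurable borel" by (intro borel_measurable_continuous_onI c)
  \<comment> \<open>A bounded continuous test function that vanishes exactly on the unit interval:
    its zero integral locates the limit measure there.\<close>
  define g where "g x = min 1 \<bar>x - c x\<bar>" for x
  have [measurable]: "g \<in> borel_measurable borel" by (simp add: g_def[abs_def])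
  have "integral\<^sup>L (\<mu> n) g = 0" for n
    by (subst integral_\<mu>) (auto simp: g_def c_id)
  moreover have "continuous_on UNIV g" unfolding g_def[abs_def] by (intro continuous_intros c)
  ultimately have "integral\<^sup>L \<nu> g = 0"
    using lim[of g] by (simp add: g_def LIMSEQ_const_iff)
  moreover have "integrable \<nu> g"
    by (rule integrable_const_bound[of _ 1]) (auto simp: g_def)
  ultimately have "AE x in \<nu>. g x = 0"
    by (subst (asm) integral_nonneg_eq_0_iff_AE) (auto simp: g_def)
  then have supp: "AE x in \<nu>. 0 \<le> x \<and> x \<le> 1"
    by eventually_elim (auto simp: g_def c_def min_def max_def split: if_splits)
  have "integral\<^sup>L \<nu> (\<lambda>x. x ^ m) = w m 0" for m
  proof -
    have "integral\<^sup>L \<nu> (\<lambda>x. x ^ m) = integral\<^sup>L \<nu> (\<lambda>x. c x ^ m)"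
    proof (rule integral_cong_AE)
      show "AE x in \<nu>. x ^ m = c x ^ m" using supp by eventually_elim (simp add: c_def)
    qed auto
    moreover have "(\<lambda>n. integral\<^sup>L (\<mu> (r n)) (\<lambda>x. c x ^ m)) \<longlonglongrightarrow> integral\<^sup>L \<nu> (\<lambda>x. c x ^ m)"
      by (rule lim) (auto intro!: continuous_intros c simp: c power_le_one abs_le_iff)
    moreover have "integral\<^sup>L (\<mu> n) (\<lambda>x. c x ^ m) = (\<Sum>k\<le>n. p n k * (real k / real n) ^ m)" for n
      by (subst integral_\<mu>) (auto simp: c_id intro!: sum.cong)
    moreover have "(\<lambda>n. \<Sum>k\<le>r n. p (r n) k * (real k / real (r n)) ^ m) \<longlonglongrightarrow> w m 0"
      using LIMSEQ_subseq_LIMSEQ[OF sum_p_power_tendsto r] by (simp add: o_def)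
    ultimately show ?thesis using LIMSEQ_unique by auto
  qed
  with prob_space_axioms sets_\<nu> supp show ?thesis by (rule that)
qed

end

text \<open>Division by the total mass reduces to the normalised case. If the mass is 0, as for the
  zero vector, \<open>rec\<close> and nonnegativity force every moment to vanish and the null
  measure serves.\<close>

lemma hausdorff_measure_exists:
  fixes w :: "nat \<Rightarrow> nat \<Rightarrow> real"
  assumes nonneg: "\<And>k l. 0 \<le> w k l" and rec: "\<And>k l. w k l = w (Suc k) l + w k (Suc l)"
  obtains \<nu> :: "real measure" where "sets \<nu> = sets borel" "emeasure \<nu> UNIV = ennreal (w 0 0)"
    "AE x in \<nu>. 0 \<le> x \<and> x \<le> 1" "\<And>n. integral\<^sup>L \<nu> (\<lambda>x. x ^ n) = w n 0"
proof (cases "w 0 0 = 0")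
  case True
  have "w n 0 = 0" for n
  proof (induction n)
    case (Suc n)
    then show ?case using rec[of n 0] nonneg[of "Suc n" 0] nonneg[of n "Suc 0"] by simp
  qed (rule True)
  then show ?thesis by (intro that[of "null_measure borel"]) (auto simp: True AE_iff_null intro: null_setsI)
next
  case False
  then have w0: "w 0 0 > 0" using nonneg[of 0 0] by simp
  interpret hausdorff "\<lambda>k l. w k l / w 0 0"
    by standard (simp add: nonneg, subst rec, simp add: add_divide_distrib)
  obtain \<nu> :: "real measure" where \<nu>: "prob_space \<nu>" "sets \<nu> = sets borel" "AE x in \<nu>. 0 \<le> x \<and> x \<le> 1"
    "\<And>n. integral\<^sup>L \<nu> (\<lambda>x. x ^ n) = w n 0 / w 0 0"
    using normalized_measure_exists False by auto
  interpret prob_space \<nu> by (rule \<nu>)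
  have [measurable_cong]: "sets \<nu> = sets borel" by (rule \<nu>)
  let ?d = "density \<nu> (\<lambda>_. ennreal (w 0 0))"
  have sp: "space \<nu> = UNIV" using sets_eq_imp_space_eq[OF \<nu>(2)] by simp
  show ?thesis
  proof (rule that[of ?d])
    show "sets ?d = sets borel" by (simp add: \<nu>)
    show "emeasure ?d UNIV = ennreal (w 0 0)"
      using emeasure_space_1 by (subst emeasure_density) (auto simp: \<nu>(2) sp)
    show "AE x in ?d. 0 \<le> x \<and> x \<le> 1"
      using \<nu>(3) by (subst AE_density) auto
    show "integral\<^sup>L ?d (\<lambda>x. x ^ n) = w n 0" for n
      using w0 by (subst integral_density) (auto simp: \<nu>(4))
  qed
qed

section \<open>The spectral theorem for positive operators\<close>

lemma positive_op_bounded_clinear: "positive_op S \<Longrightarrow> bounded_clinear S"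
  by (simp add: positive_op_def)

lemma positive_op_cinner: "positive_op S \<Longrightarrow> cinner (S h) h = of_real (Re (cinner (S h) h))"
  by (simp add: positive_op_def complex_nonneg_Reals_iff complex_eq_iff)

lemma positive_op_id: "positive_op id"
  by (rule positive_opI) (auto simp: bounded_clinear_id Re_cinner_self_nonneg)

lemma positive_op_conjugate:
  assumes U: "positive_op U" and W: "positive_op W" shows "positive_op (U \<circ> W \<circ> U)"
proof (rule positive_opI)
  show "bounded_clinear (U \<circ> W \<circ> U)"
    by (intro bounded_clinear_comp positive_op_bounded_clinear U W)
  show "0 \<le> Re (cinner ((U \<circ> W \<circ> U) h) h)" for h
    using positive_op_Re_nonneg[OF W, of "U h"] by (simp add: positive_op_selfadjoint[OF U, of "W (U h)"])
qed (simp add: positive_op_selfadjoint[OF U] positive_op_selfadjoint[OF W])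

lemma funpow_comp_commute: "U \<circ> V = V \<circ> U \<Longrightarrow> (U ^^ k) \<circ> V = V \<circ> (U ^^ k)"
  by (induction k) (auto simp: fun_eq_iff)

text \<open>A substitute for square roots: taking one factor off each side lowers an exponent by 2
  and undoes a conjugation, which preserves positivity. Exponents 0 and 1 remain, that is
  \<open>id\<close>, \<open>U\<close>, \<open>V\<close> and \<open>U \<circ> V\<close>.\<close>

lemma positive_op_funpow_comp:
  assumes U: "positive_op U" and V: "positive_op V" and UV: "positive_op (U \<circ> V)"
    and comm: "U \<circ> V = V \<circ> U"
  shows "positive_op ((U ^^ k) \<circ> (V ^^ l))"
proof -
  have V_step: "(U ^^ k) \<circ> (V ^^ Suc (Suc l)) = V \<circ> ((U ^^ k) \<circ> (V ^^ l)) \<circ> V" for k l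
    using fun_cong[OF funpow_comp_commute[OF comm, of k]]
    by (simp add: fun_eq_iff flip: funpow_swap1)
  have U_step: "(U ^^ Suc (Suc k)) \<circ> (V ^^ l) = U \<circ> ((U ^^ k) \<circ> (V ^^ l)) \<circ> U" for k l
    using fun_cong[OF funpow_comp_commute[OF comm[symmetric], of l]]
    by (simp add: fun_eq_iff flip: funpow_swap1)
  have 0: "positive_op ((U ^^ 0) \<circ> (V ^^ l))" for l
  proof (induction l rule: induct_nat_012)
    case (ge2 n)
    then show ?case unfolding V_step by (intro positive_op_conjugate V)
  qed (use V in \<open>simp_all add: positive_op_id flip: id_def\<close>)
  have 1: "positive_op ((U ^^ Suc 0) \<circ> (V ^^ l))" for l
  proof (induction l rule: induct_nat_012)
    case (ge2 n)
    then show ?case unfolding V_step by (intro positive_op_conjugate V)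
  qed (use U UV in \<open>simp_all add: o_def\<close>)
  show ?thesis
  proof (induction k rule: induct_nat_012)
    case (ge2 n)
    then show ?case unfolding U_step by (intro positive_op_conjugate U)
  qed (rule 0, rule 1)
qed

lemma power_form_family_exists:
  fixes T :: "'a::chilbert_space \<Rightarrow> 'a"
  assumes T: "positive_op T"
  obtains \<mu> M where "form_family \<mu> M" "\<And>n. form_family.rep \<mu> (\<lambda>x. x ^ n) (T ^^ n)"
proof -
  note lin = positive_op_bounded_clinear[OF T]
  obtain M where M: "M > 0" "\<And>h. norm (T h) \<le> M * norm h"
    by (blast intro: bounded_clinear_norm_bound[OF lin])
  have T_le: "Re (cinner (T h) h) \<le> M * (norm h)\<^sup>2" for h
    using Re_cinner_le_norm[of "T h" h] mult_right_mono[OF M(2)[of h], of "norm h"]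
    by (simp add: power2_eq_square)
  define V where "V h = M *\<^sub>R h - T h" for h
  have V: "positive_op V"
  proof (rule positive_opI)
    show "bounded_clinear V"
      using bounded_clinear_diff[OF bounded_clinear_scaleR[OF bounded_clinear_id] lin] by (simp add: V_def[abs_def])
    show "0 \<le> Re (cinner (V h) h)" for h
      using T_le[of h] by (simp add: V_def cinner_simps Re_cinner_self)
  qed (simp add: V_def cinner_simps positive_op_selfadjoint[OF T])
  have comm: "T \<circ> V = V \<circ> T"
    by (simp add: fun_eq_iff V_def bounded_clinear_simps[OF lin])
  \<comment> \<open>The form of \<open>T \<circ> V\<close> is
    \<open>M * Re (cinner (T h) h) - (norm (T h))\<^sup>2\<close>, nonnegative by
    \<open>positive_op_norm_square_le\<close>.\<close>
  have TV: "positive_op (T \<circ> V)"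
  proof (rule positive_opI)
    show "bounded_clinear (T \<circ> V)" by (intro bounded_clinear_comp lin positive_op_bounded_clinear V)
    show "0 \<le> Re (cinner ((T \<circ> V) h) h)" for h
      using positive_op_norm_square_le[OF T T_le, of h]
      by (simp add: V_def bounded_clinear_simps[OF lin] cinner_simps positive_op_selfadjoint[OF T, of "T h"] Re_cinner_self)
    show "cinner ((T \<circ> V) x) y = cinner x ((T \<circ> V) y)" for x y
      using fun_cong[OF comm, of x] by (simp add: positive_op_selfadjoint[OF T] positive_op_selfadjoint[OF V])
  qed
  \<comment> \<open>The power of \<open>M\<close> rescales the spectrum to the unit interval; the
    push-forward along \<open>M * x\<close> below undoes this.\<close>
  define w where "w h k l = Re (cinner ((T ^^ k) ((V ^^ l) h)) h) / M ^ (k + l)" for h k l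
  have nonneg: "0 \<le> w h k l" for h k l
    using positive_op_Re_nonneg[OF positive_op_funpow_comp[OF T V TV comm], of k l h] M by (simp add: w_def)
  have rec: "w h k l = w h (Suc k) l + w h k (Suc l)" for h k l
  proof -
    have e: "(T ^^ k) ((V ^^ Suc l) h) = M *\<^sub>R (T ^^ k) ((V ^^ l) h) - (T ^^ Suc k) ((V ^^ l) h)"
      by (simp add: V_def bounded_clinear_simps[OF bounded_clinear_funpow[OF lin]] funpow_swap1[of T])
    have "Re (cinner ((T ^^ k) ((V ^^ Suc l) h)) h)
        = M * Re (cinner ((T ^^ k) ((V ^^ l) h)) h) - Re (cinner ((T ^^ Suc k) ((V ^^ l) h)) h)"
      unfolding e by (simp add: cinner_simps del: funpow.simps)
    then show ?thesis
      unfolding w_def using M by (simp add: field_simps del: funpow.simps)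
  qed
  have "\<exists>\<nu> :: real measure. sets \<nu> = sets borel \<and> emeasure \<nu> UNIV = ennreal (w h 0 0) \<and>
    (AE x in \<nu>. 0 \<le> x \<and> x \<le> 1) \<and> (\<forall>n. integral\<^sup>L \<nu> (\<lambda>x. x ^ n) = w h n 0)" for h
    by (rule hausdorff_measure_exists[of "w h", OF nonneg rec]) blast
  then obtain \<nu> :: "'a \<Rightarrow> real measure" where \<nu>: "\<And>h. sets (\<nu> h) = sets borel" "\<And>h. emeasure (\<nu> h) UNIV = ennreal (w h 0 0)"
    "\<And>h. AE x in \<nu> h. 0 \<le> x \<and> x \<le> 1" "\<And>h n. integral\<^sup>L (\<nu> h) (\<lambda>x. x ^ n) = w h n 0"
    by metis
  note [measurable_cong] = \<nu>(1)
  have sp: "space (\<nu> h) = UNIV" for h using sets_eq_imp_space_eq[OF \<nu>(1)] by simp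
  define \<mu> where "\<mu> h = distr (\<nu> h) borel (\<lambda>x. M * x)" for h
  have fam: "form_family \<mu> M"
  proof
    show "sets (\<mu> h) = sets borel" for h by (simp add: \<mu>_def)
    show "emeasure (\<mu> h) UNIV = ennreal ((norm h)\<^sup>2)" for h
      unfolding \<mu>_def by (subst emeasure_distr) (auto simp: sp \<nu>(2) w_def Re_cinner_self)
    show "emeasure (\<mu> h) (- {0..M}) = 0" for h
    proof -
      have "AE x in \<nu> h. \<not> x \<in> (\<lambda>x. M * x) -` (- {0..M})"
        using \<nu>(3)[of h] by eventually_elim (use M in \<open>auto simp: field_simps\<close>)
      then have "emeasure (\<nu> h) ((\<lambda>x. M * x) -` (- {0..M})) = 0"
        by (subst (asm) AE_iff_measurable[OF _ refl]) (auto simp: sp \<nu>(1) vimage_def)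
      then show ?thesis
        unfolding \<mu>_def by (subst emeasure_distr) (auto simp: sp)
    qed
  qed
  interpret form_family \<mu> M by (rule fam)
  have "rep (\<lambda>x. x ^ n) (T ^^ n)" for n
    unfolding rep_def
  proof (intro conjI allI bounded_clinear_funpow lin)
    fix h
    have "integral\<^sup>L (\<mu> h) (\<lambda>x. x ^ n) = Re (cinner ((T ^^ n) h) h)"
      unfolding \<mu>_def using M \<nu>(4)[of h n]
      by (subst integral_distr) (auto simp: power_mult_distrib w_def)
    then show "cinner ((T ^^ n) h) h = of_real (integral\<^sup>L (\<mu> h) (\<lambda>x. x ^ n))"
      using positive_op_cinner[OF positive_op_funpow_comp[OF T V TV comm, of n 0]] by simp
  qed
  with fam show ?thesis by (rule that)
qed

section \<open>Operator-valued measures on the half-line and their scalar measures\<close>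

lemma space_borel_Rplus [simp]: "space borel_Rplus = {0..}"
  by (simp add: borel_Rplus_def space_restrict_space)

lemma sets_borel_Rplus_iff: "A \<in> sets borel_Rplus \<longleftrightarrow> A \<in> sets borel \<and> A \<subseteq> {0..}"
  by (auto simp: borel_Rplus_def sets_restrict_space_iff)

lemma sets_scalar_measure [simp]: "sets (scalar_measure F h) = sets borel_Rplus"
  unfolding scalar_measure_def using sets.space_closed[of borel_Rplus] sets.sigma_sets_eq[of borel_Rplus]
  by (subst sets_measure_of) auto

lemma space_scalar_measure [simp]: "space (scalar_measure F h) = {0..}"
  using sets_eq_imp_space_eq[OF sets_scalar_measure] by simp

lemma measurable_scalar_measure:
  "f \<in> borel_measurable borel \<Longrightarrow> f \<in> borel_measurable (scalar_measure F h)"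
  unfolding measurable_cong_sets[OF sets_scalar_measure refl] borel_Rplus_def
  by (rule measurable_restrict_space1)

lemma emeasure_scalar_measure:
  assumes "semispectral_measure F" "A \<in> sets borel_Rplus"
  shows "emeasure (scalar_measure F h) A = ennreal (Re (cinner (F A h) h))"
  unfolding scalar_measure_def
  by (rule emeasure_measure_of_sigma) (use assms in \<open>auto simp: semispectral_measure_def measure_space_def\<close>)

text \<open>Moves the scalar measure from the half-line to \<open>borel\<close>, where the monotone
  class results and \<open>form_family\<close> live.\<close>

definition line_measure :: "(real set \<Rightarrow> 'a::complex_inner \<Rightarrow> 'a) \<Rightarrow> 'a \<Rightarrow> real measure"
  where "line_measure F h = distr (scalar_measure F h) borel (\<lambda>x. x)"

lemma sets_line_measure [simp]: "sets (line_measure F h) = sets borel"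
  by (simp add: line_measure_def)

lemma emeasure_line_measure:
  assumes "semispectral_measure F" "A \<in> sets borel"
  shows "emeasure (line_measure F h) A = ennreal (Re (cinner (F (A \<inter> {0..}) h) h))"
  unfolding line_measure_def using assms
  by (subst emeasure_distr) (auto simp: emeasure_scalar_measure sets_borel_Rplus_iff measurable_scalar_measure)

lemma semispectral_cinner:
  assumes "semispectral_measure F" "A \<in> sets borel_Rplus"
  shows "cinner (F A h) h = of_real (Re (cinner (F A h) h))" "0 \<le> Re (cinner (F A h) h)"
  using assms by (auto simp: semispectral_measure_def complex_nonneg_Reals_iff complex_eq_iff)

lemma integral_line_measure:
  fixes f :: "real \<Rightarrow> 'b::{banach, second_countable_topology}"
  assumes "f \<in> borel_measurable borel"
  shows "integral\<^sup>L (line_measure F h) f = integral\<^sup>L (scalar_measure F h) f"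
    and "integrable (line_measure F h) f \<longleftrightarrow> integrable (scalar_measure F h) f"
  unfolding line_measure_def using assms
  by (auto simp: integral_distr integrable_distr_eq measurable_scalar_measure)

lemma has_op_integral_iff_rep:
  assumes fam: "form_family (line_measure F) M" and f: "bdd_borel M f"
  shows "has_op_integral F (\<lambda>x. complex_of_real (f x)) S \<longleftrightarrow> form_family.rep (line_measure F) f S"
proof -
  interpret form_family "line_measure F" M by (rule fam)
  have [measurable]: "f \<in> borel_measurable borel" using f by (simp add: bdd_borel_def)
  have "integrable (scalar_measure F h) (\<lambda>x. complex_of_real (f x))" for h
    using integrable_mu[OF f, of h] by (subst integral_line_measure(2)[symmetric]) auto
  moreover have "integral\<^sup>L (scalar_measure F h) (\<lambda>x. complex_of_real (f x))
      = of_real (integral\<^sup>L (line_measure F h) f)" for h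
    by (subst integral_line_measure(1)[symmetric]) auto
  ultimately show ?thesis by (simp add: has_op_integral_def rep_def)
qed

lemma rep_indicator_semispectral:
  assumes fam: "form_family (line_measure F) M" and F: "semispectral_measure F" and A: "A \<in> sets borel"
  shows "form_family.rep (line_measure F) (indicator A) (F (A \<inter> {0..}))"
proof -
  interpret form_family "line_measure F" M by (rule fam)
  have A': "A \<inter> {0..} \<in> sets borel_Rplus" using A by (simp add: sets_borel_Rplus_iff)
  have "integral\<^sup>L (line_measure F h) (indicator A) = Re (cinner (F (A \<inter> {0..}) h) h)" for h
    using A semispectral_cinner(2)[OF F A', of h] by (simp add: measure_def emeasure_line_measure[OF F])
  then show ?thesis
    unfolding rep_def using F A' semispectral_cinner(1)[OF F A'] by (auto simp: semispectral_measure_def)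
qed

lemma form_family_line_measure:
  assumes F: "semispectral_measure F" and 0: "F {M<..} = (\<lambda>_. 0)" and M: "0 \<le> M"
  shows "form_family (line_measure F) M"
proof
  show "emeasure (line_measure F h) UNIV = ennreal ((norm h)\<^sup>2)" for h
    using F by (simp add: emeasure_line_measure semispectral_measure_def Re_cinner_self)
  show "emeasure (line_measure F h) (- {0..M}) = 0" for h
  proof -
    have "- {0..M} \<inter> {0..} = {M<..}" using M by auto
    then show ?thesis using F 0 by (simp add: emeasure_line_measure)
  qed
qed simp

lemma semispectral_zero_mono:
  assumes F: "semispectral_measure F" and B: "B \<in> sets borel_Rplus" and 0: "F B = (\<lambda>_. 0)"
    and A: "A \<in> sets borel_Rplus" and "A \<subseteq> B"
  shows "F A = (\<lambda>_. 0)"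
proof (rule quadratic_form_eq_0)
  show "bounded_clinear (F A)" using F A by (simp add: semispectral_measure_def)
  fix h
  have "emeasure (scalar_measure F h) A \<le> emeasure (scalar_measure F h) B"
    using assms by (intro emeasure_mono) auto
  also have "\<dots> = 0" using F B 0 by (simp add: emeasure_scalar_measure)
  finally have "Re (cinner (F A h) h) = 0"
    using semispectral_cinner(2)[OF F A, of h] by (simp add: emeasure_scalar_measure[OF F A] ennreal_eq_0_iff)
  then show "cinner (F A h) h = 0" by (subst semispectral_cinner(1)[OF F A]) simp
qed

text \<open>Given for all larger bounds, so that two measures can later be put on one common
  interval.\<close>

lemma compactly_supported_form_family:
  assumes F: "semispectral_measure F" and K: "compactly_supported F"
  obtains M where "\<And>M'. M \<le> M' \<Longrightarrow> form_family (line_measure F) M'"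
proof -
  obtain K where K: "compact K" "K \<subseteq> {0..}" "F ({0..} - K) = (\<lambda>_. 0)"
    using K by (auto simp: compactly_supported_def)
  obtain M where M: "\<And>x. x \<in> K \<Longrightarrow> \<bar>x\<bar> \<le> M"
    using compact_imp_bounded[OF K(1)] by (auto simp: bounded_iff)
  have "form_family (line_measure F) M'" if "\<bar>M\<bar> \<le> M'" for M'
  proof (rule form_family_line_measure[OF F])
    show "F {M'<..} = (\<lambda>_. 0)"
    proof (rule semispectral_zero_mono[OF F _ K(3)])
      show "{0..} - K \<in> sets borel_Rplus"
        using compact_imp_closed[OF K(1)] by (auto simp: sets_borel_Rplus_iff)
      show "{M'<..} \<in> sets borel_Rplus" using that by (auto simp: sets_borel_Rplus_iff)
      show "{M'<..} \<subseteq> {0..} - K" using that M by fastforce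
    qed
  qed (use that in simp)
  then show ?thesis by (rule that)
qed

text \<open>Powers of \<open>T\<close> multiply correctly by construction.
  \<open>rep_multiplicative\<close> carries this over to indicators, where the product rule at
  \<open>A\<close>, \<open>A\<close> says that \<open>E A\<close> is idempotent.\<close>

lemma spectral_measure_exists:
  fixes T :: "'a::chilbert_space \<Rightarrow> 'a"
  assumes T: "positive_op T"
  obtains E where "is_spectral_measure_of E T"
proof -
  obtain \<mu> M where fam: "form_family \<mu> M" and pow: "\<And>n. form_family.rep \<mu> (\<lambda>x. x ^ n) (T ^^ n)"
    using power_form_family_exists[OF T] by blast
  interpret form_family \<mu> M by (rule fam)
  have pow_mult: "rep (\<lambda>x. x ^ i * x ^ j) ((T ^^ i) \<circ> (T ^^ j))" for i j
    using pow[of "i + j"] by (simp add: power_add funpow_add)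
  note calculus = rep_multiplicative[OF generates_bdd_borel_powers bdd_borel_power pow pow_mult]
  define E where "E A = (SOME S. rep (indicator A) S)" for A
  have E: "rep (indicator A) (E A)" if "A \<in> sets borel" for A
    unfolding E_def using calculus(1)[OF bdd_borel_indicator[OF that]] by (rule someI_ex)
  have E_cinner: "cinner (E A h) h = of_real (measure (\<mu> h) A)" if "A \<in> sets borel" for A h
    using repD(2)[OF E[OF that]] that by simp
  have "AE x in \<mu> h. x \<in> {0..}" for h using AE_supp by (rule eventually_mono) simp
  then have supp': "emeasure (\<mu> h) (A \<inter> {0..}) = emeasure (\<mu> h) A" if "A \<in> sets borel" for A h
    using that by (intro emeasure_eq_AE eventually_mono[OF \<open>AE x in \<mu> h. x \<in> {0..}\<close>]) auto
  have E_id: "E {0..} = id"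
  proof (rule quadratic_form_eqI[OF repD(1)[OF E] bounded_clinear_id])
    show "cinner (E {0..} h) h = cinner (id h) h" for h
      using supp'[of UNIV h] by (simp add: E_cinner measure_def mass cinner_self)
  qed simp
  have ss: "semispectral_measure E"
    unfolding semispectral_measure_def
  proof (intro conjI allI ballI E_id)
    fix A assume A: "A \<in> sets borel_Rplus"
    then have A': "A \<in> sets borel" by (simp add: sets_borel_Rplus_iff)
    show "bounded_clinear (E A)" by (rule repD(1)[OF E[OF A']])
    show "cinner (E A h) h \<in> \<real>\<^sub>\<ge>\<^sub>0" for h by (simp add: E_cinner[OF A'])
  next
    fix h
    interpret finite_measure "\<mu> h" by (rule finite_measure_mu)
    have "measure_space {0..} (sets borel_Rplus) (emeasure (restrict_space (\<mu> h) {0..}))"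
      using measure_space[of "restrict_space (\<mu> h) {0..}"]
      by (simp add: space_restrict_space borel_Rplus_def sets_restrict_space cong: sets_restrict_space_cong)
    moreover have "ennreal (Re (cinner (E A h) h)) = emeasure (restrict_space (\<mu> h) {0..}) A"
      if "A \<in> sets borel_Rplus" for A
      using that by (simp add: sets_borel_Rplus_iff E_cinner emeasure_restrict_space emeasure_eq_measure)
    ultimately show "measure_space {0..} (sets borel_Rplus) (\<lambda>A. ennreal (Re (cinner (E A h) h)))"
      using measure_space_eq[OF sets.space_closed[of borel_Rplus],
          of "\<lambda>A. ennreal (Re (cinner (E A h) h))" "emeasure (restrict_space (\<mu> h) {0..})"]
      by (simp add: sets.sigma_sets_eq[of borel_Rplus, simplified])
  qed
  have line: "line_measure E = \<mu>"
  proof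
    fix h
    interpret finite_measure "\<mu> h" by (rule finite_measure_mu)
    show "line_measure E h = \<mu> h"
      by (rule measure_eqI)
        (simp_all add: emeasure_line_measure[OF ss] E_cinner emeasure_eq_measure[symmetric] supp')
  qed
  have "orthogonal_projection (E A)" if "A \<in> sets borel_Rplus" for A
    unfolding orthogonal_projection_def
  proof (intro conjI allI)
    have A: "A \<in> sets borel" using that by (simp add: sets_borel_Rplus_iff)
    show "bounded_clinear (E A)" "cinner (E A x) y = cinner x (E A y)" for x y
      using repD(1)[OF E[OF A]] rep_selfadjoint[OF E[OF A]] by auto
    have "rep (\<lambda>x. indicator A x * indicator A x) (E A \<circ> E A)"
      by (rule calculus(2)[OF bdd_borel_indicator bdd_borel_indicator E E]) (rule A)+
    moreover have "(\<lambda>x. indicator A x * indicator A x) = (indicator A :: real \<Rightarrow> real)"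
      by (simp add: fun_eq_iff indicator_def)
    ultimately show "E A \<circ> E A = E A" using E[OF A] rep_unique by metis
  qed
  with ss have "spectral_measure E" by (simp add: spectral_measure_def)
  moreover have "has_op_integral E (\<lambda>x. complex_of_real x) T"
    using has_op_integral_iff_rep[of E M "\<lambda>x. x" T] pow[of 1] fam bdd_borel_power[of M 1] by (simp add: line)
  ultimately show ?thesis using that by (auto simp: is_spectral_measure_of_def)
qed

section \<open>Measures determined by moments and Stieltjes transforms\<close>

text \<open>The functions with equal integrals form a monotone class, so equality spreads from
  powers to indicators.\<close>

lemma bdd_measure_eqI_moments:
  assumes "bdd_measure \<mu> M" "bdd_measure \<nu> M"
    and moments: "\<And>n. integral\<^sup>L \<mu> (\<lambda>x. x ^ n) = integral\<^sup>L \<nu> (\<lambda>x. x ^ n)"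
  shows "\<mu> = \<nu>"
proof -
  interpret m: bdd_measure \<mu> M by fact
  interpret n: bdd_measure \<nu> M by fact
  let ?C = "{f. bdd_borel M f \<and> integral\<^sup>L \<mu> f = integral\<^sup>L \<nu> f}"
  have "mono_closed M ?C"
    unfolding mono_closed_def
  proof (intro conjI ballI allI impI)
    fix f g assume "f \<in> ?C" "g \<in> ?C"
    then show "(\<lambda>x. f x + g x) \<in> ?C"
      by (simp add: bdd_borel_add m.integrable_mu n.integrable_mu)
  next
    fix c f assume "f \<in> ?C"
    then show "(\<lambda>x. c * f x) \<in> ?C" using bdd_borel_mult[OF bdd_borel_const] by simp
  next
    fix f g assume f: "\<forall>n::nat. f n \<in> ?C" and g: "bdd_borel M g"
      and lim: "\<forall>x\<in>{0..M}. incseq (\<lambda>n. f n x) \<and> (\<lambda>n. f n x) \<longlonglongrightarrow> g x"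
    have "(\<lambda>n. integral\<^sup>L \<mu> (f n)) \<longlonglongrightarrow> integral\<^sup>L \<mu> g"
      using m.integral_mu_monotone_tendsto[of f g "\<lambda>_. 1"] f g lim by (simp add: bdd_borel_const)
    moreover have "(\<lambda>n. integral\<^sup>L \<nu> (f n)) \<longlonglongrightarrow> integral\<^sup>L \<nu> g"
      using n.integral_mu_monotone_tendsto[of f g "\<lambda>_. 1"] f g lim by (simp add: bdd_borel_const)
    ultimately show "g \<in> ?C" using f g LIMSEQ_unique by auto
  qed
  moreover have "f \<in> ?C" if "f \<in> range (\<lambda>n x. x ^ n)" for f
    using that moments by (auto simp: bdd_borel_power)
  ultimately have "f \<in> ?C" if "bdd_borel M f" for f
    by (rule generates_bdd_borelD[OF generates_bdd_borel_powers _ _ that])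
  then have "measure \<mu> A = measure \<nu> A" if "A \<in> sets borel" for A
    using bdd_borel_indicator[OF that, of M] that by force
  then show ?thesis
    using finite_measure.emeasure_eq_measure[OF m.finite_measure_mu]
      finite_measure.emeasure_eq_measure[OF n.finite_measure_mu]
    by (intro measure_eqI) auto
qed

section \<open>Stieltjes transforms and fractional moments\<close>

lemma bdd_borel_power_div: "0 < l \<Longrightarrow> bdd_borel M (\<lambda>t. t ^ n / (t + l))"
proof -
  assume l: "0 < l"
  have "bdd_borel M (\<lambda>t. 1 / (t + l))"
    by (rule bdd_borelI[where C = "1 / l"]) (use l in \<open>auto simp: frac_le\<close>)
  from bdd_borel_mult[OF bdd_borel_power this] show ?thesis by simp
qed

lemma (in bdd_measure) integral_power_div_Suc:
  assumes l: "0 < l"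
  shows "integral\<^sup>L \<mu> (\<lambda>t. t ^ Suc n / (t + l))
    = integral\<^sup>L \<mu> (\<lambda>t. t ^ n) - l * integral\<^sup>L \<mu> (\<lambda>t. t ^ n / (t + l))"
proof -
  have "integral\<^sup>L \<mu> (\<lambda>t. t ^ Suc n / (t + l)) = integral\<^sup>L \<mu> (\<lambda>t. t ^ n - l * (t ^ n / (t + l)))"
    by (intro integral_mu_cong bdd_borel_diff bdd_borel_mult bdd_borel_const bdd_borel_power_div bdd_borel_power l)
      (use l in \<open>auto simp: field_simps\<close>)
  also have "\<dots> = integral\<^sup>L \<mu> (\<lambda>t. t ^ n) - integral\<^sup>L \<mu> (\<lambda>t. l * (t ^ n / (t + l)))"
    by (intro Bochner_Integration.integral_diff integrable_mu bdd_borel_mult bdd_borel_const bdd_borel_power_div bdd_borel_power l)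
  finally show ?thesis by (simp only: integral_mult_right_zero)
qed

lemma (in bdd_measure) integral_power_div_tendsto:
  assumes l: "\<And>k. 0 < l k" "filterlim l at_top sequentially"
  shows "(\<lambda>k. l k * integral\<^sup>L \<mu> (\<lambda>t. t ^ n / (t + l k))) \<longlonglongrightarrow> integral\<^sup>L \<mu> (\<lambda>t. t ^ n)"
proof -
  have "(\<lambda>k. integral\<^sup>L \<mu> (\<lambda>t. l k * (t ^ n / (t + l k)))) \<longlonglongrightarrow> integral\<^sup>L \<mu> (\<lambda>t. t ^ n)"
  proof (rule integral_mu_tendsto[where W = "M ^ n"])
    fix t assume t: "0 \<le> t" "t \<le> M"
    show "\<bar>l k * (t ^ n / (t + l k))\<bar> \<le> M ^ n" for k
    proof -
      have "l k * (t ^ n / (t + l k)) = t ^ n * (l k / (t + l k))" by simp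
      also have "\<dots> \<le> M ^ n * 1"
        using t l(1)[of k] by (intro mult_mono power_mono) (auto simp: field_simps)
      finally show ?thesis using t l(1)[of k] by simp
    qed
    have "filterlim (\<lambda>k. t + l k) at_top sequentially"
      by (rule filterlim_tendsto_add_at_top[OF tendsto_const l(2)])
    then have "(\<lambda>k. t ^ Suc n / (t + l k)) \<longlonglongrightarrow> 0"
      by (intro tendsto_divide_0[OF tendsto_const] filterlim_at_top_imp_at_infinity)
    then have "(\<lambda>k. t ^ n - t ^ Suc n / (t + l k)) \<longlonglongrightarrow> t ^ n - 0"
      by (intro tendsto_intros)
    moreover have "t ^ n - t ^ Suc n / (t + l k) = l k * (t ^ n / (t + l k))" for k
      using t l(1)[of k] by (simp add: field_simps)
    ultimately show "(\<lambda>k. l k * (t ^ n / (t + l k))) \<longlonglongrightarrow> t ^ n" by simp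
  qed (auto intro: bdd_borel_power)
  then show ?thesis by (simp only: integral_mult_right_zero)
qed

text \<open>Moments are recovered one by one: \<open>l\<close> times the transform of order
  \<open>n\<close> tends to the \<open>n\<close>-th moment as \<open>l\<close> grows, and
  \<open>integral_power_div_Suc\<close> then gives the transform of order \<open>Suc n\<close>.
  Hence agreement at arbitrarily large \<open>l\<close> suffices, which almost everywhere agreement
  will provide.\<close>

lemma bdd_measure_eqI_Stieltjes:
  assumes "bdd_measure \<mu> M" "bdd_measure \<nu> M"
    and mass: "measure \<mu> UNIV = measure \<nu> UNIV"
    and eq: "\<And>N. \<exists>l>N. 0 < l \<and> integral\<^sup>L \<mu> (\<lambda>t. t / (t + l)) = integral\<^sup>L \<nu> (\<lambda>t. t / (t + l))"
  shows "\<mu> = \<nu>"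
proof -
  interpret m: bdd_measure \<mu> M by fact
  interpret n: bdd_measure \<nu> M by fact
  obtain l where l: "\<And>k. real k < l k" "\<And>k. 0 < l k"
    "\<And>k. integral\<^sup>L \<mu> (\<lambda>t. t / (t + l k)) = integral\<^sup>L \<nu> (\<lambda>t. t / (t + l k))"
    using eq[of "real _"] by metis
  have l_lim: "filterlim l at_top sequentially"
    by (rule filterlim_at_top_mono[OF filterlim_real_sequentially])
      (simp add: l(1) less_imp_le)
  have step: "integral\<^sup>L \<mu> (\<lambda>t. t ^ n) = integral\<^sup>L \<nu> (\<lambda>t. t ^ n)"
    if "\<And>k. integral\<^sup>L \<mu> (\<lambda>t. t ^ n / (t + l k)) = integral\<^sup>L \<nu> (\<lambda>t. t ^ n / (t + l k))" for n
    using LIMSEQ_unique[OF m.integral_power_div_tendsto[OF l(2) l_lim, of n]]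
      n.integral_power_div_tendsto[OF l(2) l_lim, of n] that by simp
  \<comment> \<open>The hypothesis is the transform of order 1, so the induction starts there; the
    moment of order 0 comes from \<open>mass\<close>.\<close>
  have "\<forall>k. integral\<^sup>L \<mu> (\<lambda>t. t ^ Suc n / (t + l k)) = integral\<^sup>L \<nu> (\<lambda>t. t ^ Suc n / (t + l k))" for n
  proof (induction n)
    case (Suc n)
    show ?case
    proof
      fix k
      show "integral\<^sup>L \<mu> (\<lambda>t. t ^ Suc (Suc n) / (t + l k)) = integral\<^sup>L \<nu> (\<lambda>t. t ^ Suc (Suc n) / (t + l k))"
        unfolding m.integral_power_div_Suc[OF l(2), of "Suc n"] n.integral_power_div_Suc[OF l(2), of "Suc n"]
        using Suc.IH step[of "Suc n"] by presburger
    qed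
  qed (simp add: l(3))
  then have "integral\<^sup>L \<mu> (\<lambda>t. t ^ Suc n) = integral\<^sup>L \<nu> (\<lambda>t. t ^ Suc n)" for n
    using step by blast
  moreover have "integral\<^sup>L \<mu> (\<lambda>t. t ^ 0) = integral\<^sup>L \<nu> (\<lambda>t. t ^ 0)"
    using mass by simp
  ultimately have "integral\<^sup>L \<mu> (\<lambda>t. t ^ n) = integral\<^sup>L \<nu> (\<lambda>t. t ^ n)" for n
    by (cases n) auto
  then show ?thesis by (rule bdd_measure_eqI_moments[OF assms(1,2)])
qed

text \<open>The integrand of the classical formula for \<open>t powr s\<close> with
  \<open>0 < s < 1\<close> as an integral over \<open>l > 0\<close>, up to a constant factor. The
  indicator allows integration against \<open>lborel\<close>.\<close>

definition stieltjes_kernel :: "real \<Rightarrow> real \<Rightarrow> real \<Rightarrow> real"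
  where "stieltjes_kernel s l t = indicator {0<..} l * (t / (t + l) * l powr (s - 1))"

lemma stieltjes_kernel_measurable [measurable]:
  "(\<lambda>x. stieltjes_kernel s (fst x) (snd x)) \<in> borel_measurable (borel \<Otimes>\<^sub>M borel)"
  "(\<lambda>l. stieltjes_kernel s l t) \<in> borel_measurable borel"
  "(\<lambda>t. stieltjes_kernel s l t) \<in> borel_measurable borel"
  unfolding stieltjes_kernel_def by measurable

text \<open>Near 0 the kernel is at most \<open>l powr (s - 1)\<close>, integrable because
  \<open>0 < s\<close>; beyond 1 it is at most \<open>l powr (s - 2)\<close>, integrable because
  \<open>s < 1\<close>. The value would be \<open>pi / sin (pi * s)\<close>, but finiteness is what
  the later subtraction of integrals requires.\<close>

lemma nn_integral_stieltjes_kernel_one_finite: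
  assumes s: "0 < s" "s < 1"
  shows "(\<integral>\<^sup>+l. ennreal (stieltjes_kernel s l 1) \<partial>lborel) < \<infinity>"
proof -
  have "(\<integral>\<^sup>+l. ennreal (stieltjes_kernel s l 1) \<partial>lborel)
      \<le> (\<integral>\<^sup>+l. ennreal (indicator {0..1} l * l powr (s - 1)) + ennreal (indicator {1..} l * l powr (s - 2)) \<partial>lborel)"
  proof (rule nn_integral_mono)
    fix l :: real
    have "stieltjes_kernel s l 1 \<le> indicator {0..1} l * l powr (s - 1) + indicator {1..} l * l powr (s - 2)"
    proof (cases "l \<le> 0")
      case False
      then have l: "l > 0" by simp
      have "1 / (1 + l) * l powr (s - 1) \<le> 1 * l powr (s - 1)"
        using l by (intro mult_right_mono) auto
      moreover have "1 / (1 + l) * l powr (s - 1) \<le> 1 / l * l powr (s - 1)"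
        using l by (intro mult_right_mono) (auto simp: field_simps)
      moreover have "1 / l * l powr (s - 1) = l powr (s - 2)"
        using l powr_diff[of l "s - 1" 1] by (simp add: diff_diff_eq)
      ultimately show ?thesis
        using l by (cases "l \<le> 1") (auto simp: stieltjes_kernel_def indicator_def intro: order_trans)
    qed (auto simp: stieltjes_kernel_def)
    then show "ennreal (stieltjes_kernel s l 1)
        \<le> ennreal (indicator {0..1} l * l powr (s - 1)) + ennreal (indicator {1..} l * l powr (s - 2))"
      by (subst ennreal_plus[symmetric]) (auto intro!: ennreal_leI simp del: ennreal_plus)
  qed
  also have "\<dots> = ennreal (1 powr (s - 1 + 1) / (s - 1 + 1)) + ennreal (- (1 powr (s - 2 + 1)) / (s - 2 + 1))"
    by (subst nn_integral_add, measurable,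
        subst nn_integral_has_integral_lebesgue[OF _ has_integral_powr_from_0],
        use s in simp, use s in simp, simp,
        subst nn_integral_has_integral_lebesgue[OF _ has_integral_powr_to_inf],
        use s in simp, use s in simp, simp, rule refl)
  also have "\<dots> < \<infinity>" by simp
  finally show ?thesis .
qed

text \<open>Substituting \<open>t * l\<close> for \<open>l\<close> extracts the power of
  \<open>t\<close> by homogeneity; the constant is left as the integral at
  \<open>t = 1\<close>.\<close>

lemma nn_integral_stieltjes_kernel:
  assumes "0 \<le> t"
  shows "(\<integral>\<^sup>+l. ennreal (stieltjes_kernel s l t) \<partial>lborel)
    = (\<integral>\<^sup>+l. ennreal (stieltjes_kernel s l 1) \<partial>lborel) * ennreal (t powr s)"
proof (cases "t = 0")
  case False
  with assms have t: "t > 0" by simp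
  have "(\<integral>\<^sup>+l. ennreal (stieltjes_kernel s l t) \<partial>lborel)
      = ennreal t * (\<integral>\<^sup>+l. ennreal (stieltjes_kernel s (t * l) t) \<partial>lborel)"
    using nn_integral_real_affine[of "\<lambda>l. ennreal (stieltjes_kernel s l t)" t 0] t by simp
  also have "(\<lambda>l. stieltjes_kernel s (t * l) t) = (\<lambda>l. t powr (s - 1) * stieltjes_kernel s l 1)"
  proof
    fix l
    show "stieltjes_kernel s (t * l) t = t powr (s - 1) * stieltjes_kernel s l 1"
    proof (cases "l > 0")
      case True
      have "t / (t + t * l) = 1 / (1 + l)"
        using t by (metis distrib_left mult.right_neutral mult_divide_mult_cancel_left_if less_irrefl)
      then show ?thesis using True t by (simp add: stieltjes_kernel_def powr_mult)
    qed (use t in \<open>auto simp: stieltjes_kernel_def zero_less_mult_iff\<close>)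
  qed
  also have "ennreal t * (\<integral>\<^sup>+l. ennreal (t powr (s - 1) * stieltjes_kernel s l 1) \<partial>lborel)
      = ennreal t * (ennreal (t powr (s - 1)) * (\<integral>\<^sup>+l. ennreal (stieltjes_kernel s l 1) \<partial>lborel))"
    by (simp add: ennreal_mult' nn_integral_cmult)
  also have "\<dots> = (\<integral>\<^sup>+l. ennreal (stieltjes_kernel s l 1) \<partial>lborel) * ennreal (t * t powr (s - 1))"
    using t by (simp add: ennreal_mult mult.commute mult.left_commute)
  also have "t * t powr (s - 1) = t powr s" using t by (simp add: powr_diff)
  finally show ?thesis .
qed (simp add: stieltjes_kernel_def)

lemma bdd_borel_div: "0 < l \<Longrightarrow> bdd_borel M (\<lambda>t. t / (t + l))"
  using bdd_borel_power_div[of l M 1] by simp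

lemma bdd_borel_powr: "0 \<le> s \<Longrightarrow> bdd_borel M (\<lambda>t. t powr s)"
  by (rule bdd_borelI[where C = "M powr s"]) (auto intro: powr_mono2)

lemma (in bdd_measure) nn_integral_stieltjes_kernel_mu:
  "(\<integral>\<^sup>+t. ennreal (stieltjes_kernel s l t) \<partial>\<mu>)
    = ennreal (indicator {0<..} l * l powr (s - 1) * integral\<^sup>L \<mu> (\<lambda>t. t / (t + l)))"
proof (cases "l > 0")
  case True
  have "(\<integral>\<^sup>+t. ennreal (l powr (s - 1) * (t / (t + l))) \<partial>\<mu>) = ennreal (integral\<^sup>L \<mu> (\<lambda>t. l powr (s - 1) * (t / (t + l))))"
  proof (rule nn_integral_eq_integral)
    show "integrable \<mu> (\<lambda>t. l powr (s - 1) * (t / (t + l)))"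
      by (intro integrable_mu bdd_borel_mult bdd_borel_const bdd_borel_div True)
    show "AE t in \<mu>. 0 \<le> l powr (s - 1) * (t / (t + l))"
      using AE_supp by eventually_elim (use True in auto)
  qed
  moreover have "stieltjes_kernel s l t = l powr (s - 1) * (t / (t + l))" for t
    using True by (simp add: stieltjes_kernel_def)
  moreover have "(indicator {0<..} l :: real) = 1" using True by simp
  ultimately show ?thesis by (simp only: integral_mult_right_zero mult_1)
qed (simp add: stieltjes_kernel_def)

lemma (in bdd_measure) nn_integral_stieltjes_kernel_swap:
  assumes s: "0 < s"
  shows "(\<integral>\<^sup>+l. (\<integral>\<^sup>+t. ennreal (stieltjes_kernel s l t) \<partial>\<mu>) \<partial>lborel)
    = (\<integral>\<^sup>+l. ennreal (stieltjes_kernel s l 1) \<partial>lborel) * ennreal (integral\<^sup>L \<mu> (\<lambda>t. t powr s))"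
proof -
  interpret finite_measure \<mu> by (rule finite_measure_mu)
  interpret pair_sigma_finite lborel \<mu> by unfold_locales
  have "(\<integral>\<^sup>+l. (\<integral>\<^sup>+t. ennreal (stieltjes_kernel s l t) \<partial>\<mu>) \<partial>lborel)
      = (\<integral>\<^sup>+t. (\<integral>\<^sup>+l. ennreal (stieltjes_kernel s l t) \<partial>lborel) \<partial>\<mu>)"
    using Fubini[of "\<lambda>x. ennreal (stieltjes_kernel s (fst x) (snd x))"] by simp
  also have "\<dots> = (\<integral>\<^sup>+t. (\<integral>\<^sup>+l. ennreal (stieltjes_kernel s l 1) \<partial>lborel) * ennreal (t powr s) \<partial>\<mu>)"
    using AE_supp by (intro nn_integral_cong_AE) (auto elim!: eventually_mono intro: nn_integral_stieltjes_kernel)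
  also have "\<dots> = (\<integral>\<^sup>+l. ennreal (stieltjes_kernel s l 1) \<partial>lborel) * (\<integral>\<^sup>+t. ennreal (t powr s) \<partial>\<mu>)"
    by (intro nn_integral_cmult) simp
  also have "(\<integral>\<^sup>+t. ennreal (t powr s) \<partial>\<mu>) = ennreal (integral\<^sup>L \<mu> (\<lambda>t. t powr s))"
    using s by (intro nn_integral_eq_integral integrable_mu bdd_borel_powr) auto
  finally show ?thesis .
qed

text \<open>\<open>t\<^sup>s\<close> is a positive mixture of the functions \<open>t / (t + l)\<close>. If the integrals of all these
  functions are ordered and those of \<open>t\<^sup>s\<close> agree, then almost all of them agree.\<close>

lemma bdd_measure_eqI_powr:
  assumes mu: "bdd_measure \<mu> M" and nu: "bdd_measure \<nu> M"
    and mass: "measure \<mu> UNIV = measure \<nu> UNIV"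
    and le: "\<And>l. 0 < l \<Longrightarrow> integral\<^sup>L \<mu> (\<lambda>t. t / (t + l)) \<le> integral\<^sup>L \<nu> (\<lambda>t. t / (t + l))"
    and s: "0 < s" "s < 1" and eq: "integral\<^sup>L \<mu> (\<lambda>t. t powr s) = integral\<^sup>L \<nu> (\<lambda>t. t powr s)"
  shows "\<mu> = \<nu>"
proof -
  interpret m: bdd_measure \<mu> M by fact
  interpret n: bdd_measure \<nu> M by fact
  define g where "g \<rho> l = (\<integral>\<^sup>+t. ennreal (stieltjes_kernel s l t) \<partial>\<rho>)" for \<rho> l
  have meas: "g \<rho> \<in> borel_measurable lborel" if "bdd_measure \<rho> M" for \<rho>
  proof -
    interpret bdd_measure \<rho> M by fact
    interpret finite_measure \<rho> by (rule finite_measure_mu)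
    show ?thesis unfolding g_def by measurable
  qed
  note [measurable] = meas[OF mu] meas[OF nu]
  have g_mu: "g \<mu> l = ennreal (indicator {0<..} l * l powr (s - 1) * integral\<^sup>L \<mu> (\<lambda>t. t / (t + l)))"
    and g_nu: "g \<nu> l = ennreal (indicator {0<..} l * l powr (s - 1) * integral\<^sup>L \<nu> (\<lambda>t. t / (t + l)))" for l
    unfolding g_def by (rule m.nn_integral_stieltjes_kernel_mu n.nn_integral_stieltjes_kernel_mu)+
  have g_le: "g \<mu> l \<le> g \<nu> l" for l
    unfolding g_mu g_nu using le[of l] by (intro ennreal_leI) (auto simp: indicator_def intro: mult_left_mono)
  have int_eq: "integral\<^sup>N lborel (g \<mu>) = integral\<^sup>N lborel (g \<nu>)"
    unfolding g_def m.nn_integral_stieltjes_kernel_swap[OF s(1)] n.nn_integral_stieltjes_kernel_swap[OF s(1)] eq ..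
  have fin: "integral\<^sup>N lborel (g \<mu>) < \<infinity>"
    unfolding g_def m.nn_integral_stieltjes_kernel_swap[OF s(1)]
    using nn_integral_stieltjes_kernel_one_finite[OF s] by (simp add: ennreal_mult_less_top)
  have "(\<integral>\<^sup>+l. g \<nu> l - g \<mu> l \<partial>lborel) = 0"
    using fin g_le int_eq by (subst nn_integral_diff) auto
  then have "AE l in lborel. g \<nu> l - g \<mu> l = 0"
    by (subst (asm) nn_integral_0_iff_AE) auto
  then have AE: "AE l in lborel. 0 < l \<longrightarrow> integral\<^sup>L \<mu> (\<lambda>t. t / (t + l)) = integral\<^sup>L \<nu> (\<lambda>t. t / (t + l))"
  proof eventually_elim
    case (elim l)
    show ?case
    proof
      assume l: "0 < l"
      have "0 \<le> integral\<^sup>L \<mu> (\<lambda>t. t / (t + l))"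
        using m.integral_mu_mono[OF bdd_borel_const[of _ 0] bdd_borel_div[OF l]] l by simp
      moreover have "g \<nu> l \<le> g \<mu> l"
        using elim by (simp add: diff_eq_0_iff_ennreal g_mu g_nu)
      ultimately have "integral\<^sup>L \<nu> (\<lambda>t. t / (t + l)) \<le> integral\<^sup>L \<mu> (\<lambda>t. t / (t + l))"
        using l by (simp add: g_mu g_nu ennreal_le_iff)
      with le[OF l] show "integral\<^sup>L \<mu> (\<lambda>t. t / (t + l)) = integral\<^sup>L \<nu> (\<lambda>t. t / (t + l))" by simp
    qed
  qed
  show ?thesis
  proof (rule bdd_measure_eqI_Stieltjes[OF mu nu mass])
    fix N
    show "\<exists>l>N. 0 < l \<and> integral\<^sup>L \<mu> (\<lambda>t. t / (t + l)) = integral\<^sup>L \<nu> (\<lambda>t. t / (t + l))"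
    proof (rule ccontr)
      assume neg: "\<not> ?thesis"
      have "AE l in lborel. l \<notin> {max 0 N<..<max 0 N + 1}"
        using AE by eventually_elim (use neg in auto)
      then have "emeasure lborel {max 0 N<..<max 0 N + 1} = 0"
        by (subst (asm) AE_iff_measurable[where N = "{max 0 N<..<max 0 N + 1}"]) auto
      then show False by simp
    qed
  qed
qed

section \<open>Comparison of a semispectral with a spectral measure\<close>

context form_family
begin

lemma rep_indicator_cinner:
  assumes "rep (indicator A) S" "A \<in> sets borel"
  shows "cinner (S h) h = of_real (measure (\<mu> h) A)"
  using repD(2)[OF assms(1), of h] assms(2) by simp

text \<open>Nonnegativity of the form of \<open>S\<close> at \<open>h - c *\<^sub>R k\<close>,
  divided by \<open>c\<close>. The free weight \<open>c\<close> will be an approximate value of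
  \<open>y\<close> on \<open>A\<close>.\<close>

lemma rep_indicator_quadratic:
  assumes S: "rep (indicator A) S" and A: "A \<in> sets borel" and c: "c > 0"
  shows "2 * Re (cinner (S h) k) \<le> (1 / c) * measure (\<mu> h) A + c * measure (\<mu> k) A"
proof -
  have "0 \<le> Re (cinner (S (h - c *\<^sub>R k)) (h - c *\<^sub>R k))"
    by (simp add: rep_indicator_cinner[OF S A])
  also have "\<dots> = Re (cinner (S h) h) - 2 * c * Re (cinner (S h) k) + c * c * Re (cinner (S k) k)"
    using rep_selfadjoint[OF S, of k h] Re_cinner_commute[of k "S h"]
    by (simp add: bounded_clinear_simps[OF repD(1)[OF S]] cinner_simps algebra_simps)
  finally have "2 * c * Re (cinner (S h) k) \<le> measure (\<mu> h) A + c * c * measure (\<mu> k) A"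
    by (simp add: rep_indicator_cinner[OF S A])
  then show ?thesis using c by (simp add: field_simps)
qed

text \<open>Expresses mixed terms by measures, so that their sum over a partition becomes an
  integral.\<close>

lemma rep_indicator_polarization:
  assumes S: "rep (indicator A) S" and A: "A \<in> sets borel"
  shows "4 * Re (cinner (S h) k) = measure (\<mu> (h + k)) A - measure (\<mu> (h - k)) A"
proof -
  have "measure (\<mu> x) A = Re (cinner (S x) x)" for x by (simp add: rep_indicator_cinner[OF S A])
  then show ?thesis
    using rep_selfadjoint[OF S, of k h] Re_cinner_commute[of k "S h"]
    by (simp add: bounded_clinear_simps[OF repD(1)[OF S]] cinner_simps)
qed

text \<open>On a set where \<open>y\<close> is nearly a constant \<open>c\<close> the claim is the arithmetic-geometric mean
  inequality for the form \<open>\<langle>F(A) h, k\<rangle>\<close>. The sets are the fibres of \<open>\<lfloor>log\<^sub>r y\<rfloor>\<close>, and \<open>r\<close> tends to \<open>1\<close>.\<close>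

lemma cinner_le_integral_inverse:
  assumes P: "\<And>A. A \<in> sets borel \<Longrightarrow> rep (indicator A) (P A)"
    and y: "bdd_borel M y" and c: "c > 0" "\<And>x. 0 \<le> x \<Longrightarrow> x \<le> M \<Longrightarrow> c \<le> y x"
  shows "2 * Re (cinner h k) \<le> integral\<^sup>L (\<mu> h) (\<lambda>x. 1 / y x) + integral\<^sup>L (\<mu> k) y"
proof -
  obtain C where C: "\<And>x. 0 \<le> x \<Longrightarrow> x \<le> M \<Longrightarrow> \<bar>y x\<bar> \<le> C" by (blast intro: bdd_borel_bound[OF y])
  define D where "D = max c C"
  \<comment> \<open>\<open>y\<close> clamped between \<open>c\<close> and \<open>D\<close>: the
    bounds now hold on the whole line, so finitely many fibres cover it.\<close>
  define z where "z x = max c (min D (y x))" for x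
  have [measurable]: "y \<in> borel_measurable borel" using y by (simp add: bdd_borel_def)
  have [measurable]: "z \<in> borel_measurable borel" unfolding z_def[abs_def] by measurable
  have z: "c \<le> z x" "z x \<le> D" for x by (auto simp: z_def D_def)
  have z_pos: "0 < z x" for x using z(1)[of x] c by simp
  have zy: "z x = y x" if "0 \<le> x" "x \<le> M" for x
    using c(2)[OF that] C[OF that] by (auto simp: z_def D_def)
  have bz: "bdd_borel M z" by (rule bdd_borelI[where C = D]) (use z z_pos in \<open>auto simp: abs_of_pos\<close>)
  have inv_z: "0 \<le> 1 / z x" "1 / z x \<le> 1 / c" for x
    using z(1)[of x] c z_pos[of x] by (auto intro: frac_le)
  have binv: "bdd_borel M (\<lambda>x. 1 / z x)"
    by (rule bdd_borelI[where C = "1 / c"]) (use inv_z in auto)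
  have approx: "2 * Re (cinner h k) \<le> r * integral\<^sup>L (\<mu> h) (\<lambda>x. 1 / z x) + integral\<^sup>L (\<mu> k) z" if r: "r > 1" for r
  proof -
    define idx where "idx x = \<lfloor>log r (z x)\<rfloor>" for x
    define I where "I = {\<lfloor>log r c\<rfloor>..\<lfloor>log r D\<rfloor>}"
    define A where "A i = {x. idx x = i}" for i
    have idx_I: "idx x \<in> I" for x
      unfolding idx_def I_def using z[of x] c r z_pos[of x] by (auto intro!: floor_mono)
    have A [measurable]: "A i \<in> sets borel" for i
      unfolding A_def idx_def by measurable
    have fin: "finite I" by (simp add: I_def)
    have fibres: "(\<Sum>i\<in>I. f i * indicator (A i) x) = f (idx x)" for f :: "int \<Rightarrow> real" and x
    proof -
      have "(\<Sum>i\<in>I. f i * indicator (A i) x) = (\<Sum>i\<in>I. if idx x = i then f i else 0)"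
        by (rule sum.cong) (auto simp: A_def)
      then show ?thesis using idx_I[of x] fin by simp
    qed
    have sum_measure: "(\<Sum>i\<in>I. f i * measure (\<mu> x) (A i)) = integral\<^sup>L (\<mu> x) (\<lambda>t. f (idx t))" for f x
    proof -
      have "integrable (\<mu> x) (\<lambda>t. f i * indicator (A i) t)" for i
        by (intro integrable_mu bdd_borel_mult bdd_borel_const bdd_borel_indicator A)
      then have "integral\<^sup>L (\<mu> x) (\<lambda>t. \<Sum>i\<in>I. f i * indicator (A i) t) = (\<Sum>i\<in>I. f i * measure (\<mu> x) (A i))"
        by (subst Bochner_Integration.integral_sum) auto
      then show ?thesis unfolding fibres by simp
    qed
    have total: "(\<Sum>i\<in>I. Re (cinner (P (A i) h) k)) = Re (cinner h k)"
    proof -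
      have "4 * (\<Sum>i\<in>I. Re (cinner (P (A i) h) k))
          = (\<Sum>i\<in>I. 1 * measure (\<mu> (h + k)) (A i)) - (\<Sum>i\<in>I. 1 * measure (\<mu> (h - k)) (A i))"
        by (simp add: sum_distrib_left rep_indicator_polarization[OF P[OF A] A] sum_subtractf)
      also have "\<dots> = Re (cinner (h + k) (h + k)) - Re (cinner (h - k) (h - k))"
        unfolding sum_measure by (simp add: measure_UNIV_mu Re_cinner_self)
      also have "\<dots> = 4 * Re (cinner h k)"
        using Re_cinner_commute[of k h] by (simp add: cinner_simps)
      finally show ?thesis by simp
    qed
    \<comment> \<open>Rounding is downwards, so the factor \<open>r\<close> is lost only in the term
      with the inverse.\<close>
    have powr_idx: "r powr idx x \<le> z x" "z x \<le> r * r powr idx x" for x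
    proof -
      have "r powr idx x \<le> r powr (log r (z x))"
        unfolding idx_def using r by (intro powr_mono) auto
      then show "r powr idx x \<le> z x" using r z_pos[of x] by simp
      have "r powr (log r (z x)) \<le> r powr (1 + idx x)"
        unfolding idx_def using r by (intro powr_mono) linarith+
      then show "z x \<le> r * r powr idx x" using r z_pos[of x] by (simp add: powr_add)
    qed
    have meas_idx [measurable]: "(\<lambda>x. r powr idx x) \<in> borel_measurable borel"
      unfolding idx_def by measurable
    have b1: "bdd_borel M (\<lambda>x. r powr idx x)"
      by (rule bdd_borelI[where C = D]) (use powr_idx(1) z(2) in \<open>auto intro: order_trans\<close>)
    have inv_idx: "1 / r powr idx x \<le> r * (1 / z x)" for x
      using powr_idx(2)[of x] z_pos[of x] r by (simp add: field_simps)
    have b2: "bdd_borel M (\<lambda>x. 1 / r powr idx x)"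
    proof (rule bdd_borelI[where C = "r * (1 / c)"])
      show "\<bar>1 / r powr idx x\<bar> \<le> r * (1 / c)" for x
        using inv_idx[of x] mult_left_mono[OF inv_z(2)[of x], of r] r by simp
    qed simp
    have "2 * Re (cinner h k) = (\<Sum>i\<in>I. 2 * Re (cinner (P (A i) h) k))"
      by (simp add: total flip: sum_distrib_left)
    also have "\<dots> \<le> (\<Sum>i\<in>I. (1 / r powr i) * measure (\<mu> h) (A i) + r powr i * measure (\<mu> k) (A i))"
      using r by (intro sum_mono rep_indicator_quadratic[OF P[OF A] A]) auto
    also have "\<dots> = integral\<^sup>L (\<mu> h) (\<lambda>x. 1 / r powr idx x) + integral\<^sup>L (\<mu> k) (\<lambda>x. r powr idx x)"
      by (simp only: sum.distrib sum_measure)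
    also have "\<dots> \<le> integral\<^sup>L (\<mu> h) (\<lambda>x. r * (1 / z x)) + integral\<^sup>L (\<mu> k) z"
      by (intro add_mono integral_mu_mono b1 b2 bz bdd_borel_mult bdd_borel_const binv inv_idx powr_idx)
    finally show ?thesis by (simp only: integral_mult_right_zero)
  qed
  have "2 * Re (cinner h k) \<le> integral\<^sup>L (\<mu> h) (\<lambda>x. 1 / z x) + integral\<^sup>L (\<mu> k) z"
  proof (rule LIMSEQ_le_const)
    have "(\<lambda>n. (1 + inverse (real (Suc n))) * integral\<^sup>L (\<mu> h) (\<lambda>x. 1 / z x) + integral\<^sup>L (\<mu> k) z)
        \<longlonglongrightarrow> (1 + 0) * integral\<^sup>L (\<mu> h) (\<lambda>x. 1 / z x) + integral\<^sup>L (\<mu> k) z"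
      by (intro tendsto_intros LIMSEQ_inverse_real_of_nat)
    then show "(\<lambda>n. (1 + inverse (real (Suc n))) * integral\<^sup>L (\<mu> h) (\<lambda>x. 1 / z x) + integral\<^sup>L (\<mu> k) z)
        \<longlonglongrightarrow> integral\<^sup>L (\<mu> h) (\<lambda>x. 1 / z x) + integral\<^sup>L (\<mu> k) z" by simp
  qed (auto intro!: approx)
  moreover have "integral\<^sup>L (\<mu> h) (\<lambda>x. 1 / z x) = integral\<^sup>L (\<mu> h) (\<lambda>x. 1 / y x)"
  proof (rule integral_cong_AE)
    show "AE x in \<mu> h. 1 / z x = 1 / y x" using AE_supp by (rule eventually_mono) (simp add: zy)
  qed auto
  moreover have "integral\<^sup>L (\<mu> k) z = integral\<^sup>L (\<mu> k) y"
    by (rule integral_mu_cong[OF bz y zy])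
  ultimately show ?thesis by simp
qed

text \<open>A projection-valued measure is multiplicative: a vector in the range of
  \<open>P A\<close> has all its mass on \<open>A\<close>, so a set disjoint from \<open>A\<close>
  has mass 0 and its projection kills the vector. The general case splits \<open>A\<close> and
  \<open>B\<close> along their intersection.\<close>

lemma rep_indicator_mult:
  assumes P: "\<And>A. A \<in> sets borel \<Longrightarrow> rep (indicator A) (P A)"
    and idem: "\<And>A. A \<in> sets borel \<Longrightarrow> P A \<circ> P A = P A"
    and A: "A \<in> sets borel" and B: "B \<in> sets borel"
  shows "rep (\<lambda>x. indicator A x * indicator B x) (P A \<circ> P B)"
proof -
  have idem': "P A (P A h) = P A h" if "A \<in> sets borel" for A h
    using fun_cong[OF idem[OF that], of h] by simp
  have disjoint: "P B (P A h) = 0"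
    if A: "A \<in> sets borel" and B: "B \<in> sets borel" and AB: "A \<inter> B = {}" for A B h
  proof -
    interpret fm: finite_measure "\<mu> (P A h)" by (rule finite_measure_mu)
    let ?x = "P A h"
    have "measure (\<mu> ?x) A = (norm ?x)\<^sup>2"
      using rep_indicator_cinner[OF P[OF A] A, of ?x] by (simp add: idem'[OF A] cinner_self del: of_real_power)
    moreover have "measure (\<mu> ?x) (A \<union> B) \<le> measure (\<mu> ?x) UNIV"
      using A B fm.bounded_measure[of "A \<union> B"] by simp
    moreover have "measure (\<mu> ?x) (A \<union> B) = measure (\<mu> ?x) A + measure (\<mu> ?x) B"
      using A B AB by (intro fm.finite_measure_Union) auto
    ultimately have "measure (\<mu> ?x) B = 0"
      using measure_nonneg[of "\<mu> ?x" B] by (simp add: measure_UNIV_mu)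
    then have "cinner (P B ?x) ?x = 0"
      by (simp add: rep_indicator_cinner[OF P[OF B] B])
    then have "cinner (P B ?x) (P B ?x) = 0"
      using rep_selfadjoint[OF P[OF B], of "P B ?x" ?x] by (simp add: idem'[OF B])
    then show ?thesis by (simp add: cinner_self)
  qed
  have split: "P A h = P (A \<inter> B) h + P (A - B) h" if A: "A \<in> sets borel" and B: "B \<in> sets borel" for A B h
  proof -
    have AB: "A \<inter> B \<in> sets borel" "A - B \<in> sets borel" using A B by auto
    have "rep (\<lambda>x. indicator (A \<inter> B) x + indicator (A - B) x) (\<lambda>h. P (A \<inter> B) h + P (A - B) h)"
      by (intro rep_add bdd_borel_indicator P AB)
    moreover have "(\<lambda>x. indicator (A \<inter> B) x + indicator (A - B) x) = (indicator A :: real \<Rightarrow> real)"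
      by (auto simp: fun_eq_iff indicator_def)
    ultimately show ?thesis using rep_unique[OF P[OF A]] by metis
  qed
  have AB: "A \<inter> B \<in> sets borel" "A - B \<in> sets borel" "B - A \<in> sets borel" using A B by auto
  have "P A (P B h) = P (A \<inter> B) h" for h
  proof -
    have "P A (P B h) = P A (P (A \<inter> B) h) + P A (P (B - A) h)"
      using split[OF B A, of h] by (simp add: bounded_clinear_simps[OF repD(1)[OF P[OF A]]] Int_commute)
    also have "P A (P (B - A) h) = 0" by (rule disjoint) (use A AB in auto)
    also have "P A (P (A \<inter> B) h) = P (A \<inter> B) (P (A \<inter> B) h) + P (A - B) (P (A \<inter> B) h)"
      by (rule split[OF A B])
    also have "P (A - B) (P (A \<inter> B) h) = 0" by (rule disjoint) (use AB in auto)
    finally show ?thesis by (simp add: idem'[OF AB(1)])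
  qed
  then have "P A \<circ> P B = P (A \<inter> B)" by auto
  moreover have "(\<lambda>x. indicator A x * indicator B x) = (indicator (A \<inter> B) :: real \<Rightarrow> real)"
    by (auto simp: fun_eq_iff indicator_def)
  ultimately show ?thesis using P[OF AB(1)] by simp
qed

text \<open>Asks only that indicators be represented, so it serves \<open>F\<close> as well, where
  no product rule is available.\<close>

lemma rep_exists:
  assumes P: "\<And>A. A \<in> sets borel \<Longrightarrow> rep (indicator A) (P A)" and f: "bdd_borel M f"
  shows "\<exists>S. rep f S"
proof -
  have "f \<in> {f. bdd_borel M f \<and> (\<exists>S. rep f S \<and> rep (\<lambda>x. f x * 1) (S \<circ> id))}"
    by (rule generates_bdd_borelD[OF generates_bdd_borel_indicators
          mono_closed_rep[OF bdd_borel_const bounded_clinear_id] _ f])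
      (use P in \<open>auto simp: bdd_borel_indicator\<close>)
  then show ?thesis by auto
qed

lemma rep_mult_of_idempotent:
  assumes P: "\<And>A. A \<in> sets borel \<Longrightarrow> rep (indicator A) (P A)"
    and idem: "\<And>A. A \<in> sets borel \<Longrightarrow> P A \<circ> P A = P A"
    and f: "bdd_borel M f" "rep f S" and g: "bdd_borel M g" "rep g R"
  shows "rep (\<lambda>x. f x * g x) (S \<circ> R)"
proof (rule rep_multiplicative(2)[OF generates_bdd_borel_indicators _ _ _ f(1) g(1) f(2) g(2)])
  show "rep (\<lambda>x. indicator A x * indicator B x) (P A \<circ> P B)" if "A \<in> sets borel" "B \<in> sets borel" for A B
    using P idem that by (rule rep_indicator_mult)
qed (use P in \<open>auto intro: bdd_borel_indicator\<close>)

text \<open>Pushing forward along \<open>x powr b\<close> turns the orders \<open>a < b\<close> into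
  \<open>a / b < 1\<close> and 1, the setting of \<open>bdd_measure_eqI_powr\<close>.\<close>

lemma powr_bdd_measure:
  assumes "0 < b"
  shows "bdd_measure (distr (\<mu> h) borel (\<lambda>x. x powr b)) (M powr b)"
proof
  show "emeasure (distr (\<mu> h) borel (\<lambda>x. x powr b)) UNIV \<noteq> \<infinity>"
    by (subst emeasure_distr) (auto simp: mass)
  show "AE x in distr (\<mu> h) borel (\<lambda>x. x powr b). 0 \<le> x \<and> x \<le> M powr b"
  proof (subst AE_distr_iff)
    show "AE x in \<mu> h. 0 \<le> x powr b \<and> x powr b \<le> M powr b"
      using AE_supp by eventually_elim (use assms in \<open>auto intro: powr_mono2\<close>)
  qed auto
qed simp

end

text \<open>The families enter asymmetrically: positivity of the operators \<open>P A\<close> gives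
  the inequality for \<open>\<mu>\<close>, while idempotence of the \<open>Q A\<close> makes the
  operators of \<open>?y\<close> and \<open>1 / ?y\<close> inverse to each other, so that equality
  is attained for \<open>\<nu>\<close>.\<close>

lemma form_family_eqI_powr:
  fixes \<mu> \<nu> :: "'a::chilbert_space \<Rightarrow> real measure"
  assumes mu: "form_family \<mu> M" and nu: "form_family \<nu> M"
    and P: "\<And>A. A \<in> sets borel \<Longrightarrow> form_family.rep \<mu> (indicator A) (P A)"
    and Q: "\<And>A. A \<in> sets borel \<Longrightarrow> form_family.rep \<nu> (indicator A) (Q A)"
    and idem: "\<And>A. A \<in> sets borel \<Longrightarrow> Q A \<circ> Q A = Q A"
    and ab: "0 < a" "a < b"
    and eq: "\<And>h. integral\<^sup>L (\<mu> h) (\<lambda>x. x powr a) = integral\<^sup>L (\<nu> h) (\<lambda>x. x powr a)"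
      "\<And>h. integral\<^sup>L (\<mu> h) (\<lambda>x. x powr b) = integral\<^sup>L (\<nu> h) (\<lambda>x. x powr b)"
  shows "\<mu> = \<nu>"
proof
  fix h
  interpret m: form_family \<mu> M by (rule mu)
  interpret n: form_family \<nu> M by (rule nu)
  have b: "0 < b" using ab by simp
  let ?\<mu> = "distr (\<mu> h) borel (\<lambda>x. x powr b)" and ?\<nu> = "distr (\<nu> h) borel (\<lambda>x. x powr b)"
  have transfer: "integral\<^sup>L ?\<mu> f = integral\<^sup>L (\<mu> h) (\<lambda>x. f (x powr b))"
    "integral\<^sup>L ?\<nu> f = integral\<^sup>L (\<nu> h) (\<lambda>x. f (x powr b))"
    if "f \<in> borel_measurable borel" for f :: "real \<Rightarrow> real"
    using that by (auto simp: integral_distr)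
  have push_eq: "?\<mu> = ?\<nu>"
  proof (rule bdd_measure_eqI_powr[OF m.powr_bdd_measure[OF b] n.powr_bdd_measure[OF b], where s = "a / b"])
    show "measure ?\<mu> UNIV = measure ?\<nu> UNIV"
      by (simp add: measure_distr m.measure_UNIV_mu n.measure_UNIV_mu)
    show "0 < a / b" "a / b < 1" using ab by auto
    show "integral\<^sup>L ?\<mu> (\<lambda>t. t powr (a / b)) = integral\<^sup>L ?\<nu> (\<lambda>t. t powr (a / b))"
      using b eq(1)[of h] by (simp add: transfer powr_powr)
    fix l :: real assume l: "0 < l"
    let ?y = "\<lambda>x. x powr b + l"
    have ge_l: "l \<le> ?y x" for x :: real using powr_ge_zero[of x b] by linarith
    have pos: "0 < ?y x" for x :: real using l ge_l[of x] by linarith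
    have y: "bdd_borel M ?y" using b by (intro bdd_borel_add bdd_borel_powr bdd_borel_const) simp
    have inv: "bdd_borel M (\<lambda>x. 1 / ?y x)"
      by (rule bdd_borelI[where C = "1 / l"]) (use l pos in \<open>auto simp: frac_le abs_of_pos\<close>)
    obtain Y S where Y: "n.rep ?y Y" and S: "n.rep (\<lambda>x. 1 / ?y x) S"
      using n.rep_exists[OF Q y] n.rep_exists[OF Q inv] by blast
    have "n.rep (\<lambda>x. ?y x * (1 / ?y x)) (Y \<circ> S)"
      by (rule n.rep_mult_of_idempotent[OF Q idem y Y inv S])
    moreover have "(\<lambda>x. ?y x * (1 / ?y x)) = (\<lambda>_. 1)" using pos by (auto simp: fun_eq_iff less_le)
    ultimately have YS: "Y (S x) = x" for x
      using n.rep_unique[OF n.rep_one, of "Y \<circ> S"] by (metis comp_apply id_apply)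
    define J where "J = integral\<^sup>L (\<nu> h) (\<lambda>x. 1 / ?y x)"
    have ShJ: "Re (cinner (S h) h) = J" using n.repD(2)[OF S, of h] by (simp add: J_def)
    \<comment> \<open>By \<open>YS\<close> the form of \<open>Y\<close> at \<open>S h\<close> is
      \<open>cinner h (S h)\<close>. The inequality below then reads \<open>2 * J\<close> on the
      left and the wanted integral plus \<open>J\<close> on the right.\<close>
    have "integral\<^sup>L (\<nu> (S h)) ?y = J"
      using n.repD(2)[OF Y, of "S h"] ShJ Re_cinner_commute[of h "S h"] by (simp add: YS)
    moreover have "integral\<^sup>L (\<mu> (S h)) ?y = integral\<^sup>L (\<nu> (S h)) ?y"
      using b by (simp add: m.integrable_mu n.integrable_mu bdd_borel_powr bdd_borel_const eq(2)
          m.measure_UNIV_mu n.measure_UNIV_mu)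
    moreover have "2 * Re (cinner h (S h)) \<le> integral\<^sup>L (\<mu> h) (\<lambda>x. 1 / ?y x) + integral\<^sup>L (\<mu> (S h)) ?y"
      by (rule m.cinner_le_integral_inverse[OF P y l ge_l])
    ultimately have J_le: "J \<le> integral\<^sup>L (\<mu> h) (\<lambda>x. 1 / ?y x)"
      using ShJ Re_cinner_commute[of h "S h"] by simp
    have split: "(\<lambda>x. x powr b / ?y x) = (\<lambda>x. 1 - l * (1 / ?y x))"
    proof
      fix x :: real
      show "x powr b / ?y x = 1 - l * (1 / ?y x)" using pos[of x] by (simp add: field_simps)
    qed
    have mu_split: "integral\<^sup>L (\<mu> h) (\<lambda>x. x powr b / ?y x) = (norm h)\<^sup>2 - l * integral\<^sup>L (\<mu> h) (\<lambda>x. 1 / ?y x)"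
      unfolding split
      by (subst Bochner_Integration.integral_diff)
        (auto intro!: m.integrable_mu bdd_borel_const bdd_borel_mult inv simp only: m.integral_mu_const integral_mult_right_zero mult_1)
    have nu_split: "integral\<^sup>L (\<nu> h) (\<lambda>x. x powr b / ?y x) = (norm h)\<^sup>2 - l * J"
      unfolding split J_def
      by (subst Bochner_Integration.integral_diff)
        (auto intro!: n.integrable_mu bdd_borel_const bdd_borel_mult inv simp only: n.integral_mu_const integral_mult_right_zero mult_1)
    show "integral\<^sup>L ?\<mu> (\<lambda>t. t / (t + l)) \<le> integral\<^sup>L ?\<nu> (\<lambda>t. t / (t + l))"
      using J_le l by (simp add: transfer mu_split nu_split)
  qed
  show "\<mu> h = \<nu> h"
  \<comment> \<open>The push-forward loses nothing on the half-line, where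
    \<open>powr (1 / b)\<close> inverts \<open>powr b\<close>; so each moment is an integral against
    the common image measure.\<close>
  proof (rule bdd_measure_eqI_moments)
    show "bdd_measure (\<mu> h) M" "bdd_measure (\<nu> h) M" by unfold_locales
    fix k
    have bp: "bdd_borel M (\<lambda>x. ((x powr b) powr (1 / b)) ^ k)"
      using b by (intro bdd_borelI[where C = "M ^ k"]) (auto simp: powr_powr intro!: power_mono)
    have "((x powr b) powr (1 / b)) ^ k = x ^ k" if "0 \<le> x" for x :: real
      using b that by (simp add: powr_powr)
    then have "integral\<^sup>L (\<mu> h) (\<lambda>x. x ^ k) = integral\<^sup>L (\<mu> h) (\<lambda>x. ((x powr b) powr (1 / b)) ^ k)"
      "integral\<^sup>L (\<nu> h) (\<lambda>x. x ^ k) = integral\<^sup>L (\<nu> h) (\<lambda>x. ((x powr b) powr (1 / b)) ^ k)"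
      by (auto intro!: m.integral_mu_cong n.integral_mu_cong bdd_borel_power bp)
    then show "integral\<^sup>L (\<mu> h) (\<lambda>x. x ^ k) = integral\<^sup>L (\<nu> h) (\<lambda>x. x ^ k)"
      using push_eq transfer[of "\<lambda>t. (t powr (1 / b)) ^ k"] by simp
  qed
qed

section \<open>The equivalences\<close>

lemma spectral_idempotent:
  "spectral_measure E \<Longrightarrow> A \<in> sets borel \<Longrightarrow> E (A \<inter> {0..}) \<circ> E (A \<inter> {0..}) = E (A \<inter> {0..})"
  by (simp add: spectral_measure_def orthogonal_projection_def sets_borel_Rplus_iff)

text \<open>A vector in the range of \<open>E((K, \<infinity>))\<close> with \<open>K\<close> a bound of \<open>T\<close> has its scalar measure on
  \<open>(K, \<infinity>)\<close>, which forces \<open>\<langle>T h, h\<rangle> > K \<parallel>h\<parallel>\<^sup>2\<close> unless it is \<open>0\<close>.\<close>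

lemma spectral_measure_of_form_family:
  fixes T :: "'a::chilbert_space \<Rightarrow> 'a"
  assumes E: "is_spectral_measure_of E T"
  obtains M where "\<And>M'. M \<le> M' \<Longrightarrow> form_family (line_measure E) M'"
proof -
  have sp: "spectral_measure E" and T: "has_op_integral E (\<lambda>x. complex_of_real x) T"
    using E by (auto simp: is_spectral_measure_of_def)
  then have ss: "semispectral_measure E" by (simp add: spectral_measure_def)
  obtain K where K: "K > 0" "\<And>h. norm (T h) \<le> K * norm h"
    using T by (auto simp: has_op_integral_def intro: bounded_clinear_norm_bound[of T])
  have "E {K'<..} = (\<lambda>_. 0)" if K': "K \<le> K'" for K'
  proof
    fix h
    let ?A = "{K'<..}"
    have A: "?A \<in> sets borel_Rplus" using K K' by (auto simp: sets_borel_Rplus_iff)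
    define x where "x = E ?A h"
    have "E ?A \<circ> E ?A = E ?A"
      using sp A by (simp add: spectral_measure_def orthogonal_projection_def)
    from fun_cong[OF this, of h] have Ex: "E ?A x = x" by (simp add: x_def)
    let ?N = "scalar_measure E x"
    have mass: "emeasure ?N {0..} = ennreal ((norm x)\<^sup>2)"
      using ss by (simp add: emeasure_scalar_measure sets_borel_Rplus_iff semispectral_measure_def Re_cinner_self)
    interpret finite_measure ?N by (rule finite_measureI) (simp add: mass)
    have "emeasure ?N ?A = ennreal ((norm x)\<^sup>2)"
      by (simp add: emeasure_scalar_measure[OF ss A] Ex Re_cinner_self)
    then have "emeasure ?N (space ?N - ?A) = 0"
      using A by (subst emeasure_compl) (auto simp: mass)
    then have AE: "AE y in ?N. K' < y"
      by (intro AE_I[of _ _ "space ?N - ?A"]) (use A sets.compl_sets[of ?A ?N] in auto)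
    have cint: "integrable ?N (\<lambda>y. complex_of_real y)" and Tx: "cinner (T x) x = integral\<^sup>L ?N (\<lambda>y. complex_of_real y)"
      using T by (auto simp: has_op_integral_def)
    have int: "integrable ?N (\<lambda>y. y)" using integrable_Re[OF cint] by simp
    have "integral\<^sup>L ?N (\<lambda>y. y) = Re (cinner (T x) x)" unfolding Tx by (simp flip: integral_Re[OF cint])
    also have "\<dots> \<le> norm (T x) * norm x" by (rule Re_cinner_le_norm)
    also have "\<dots> \<le> K' * norm x * norm x"
      using K(2)[of x] mult_right_mono[OF K', of "norm x"] by (intro mult_right_mono) auto
    finally have le: "integral\<^sup>L ?N (\<lambda>y. y - K') \<le> 0"
      using int mass by (simp add: measure_def power2_eq_square mult.commute mult.left_commute)
    have "0 \<le> integral\<^sup>L ?N (\<lambda>y. y - K')"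
      by (rule integral_nonneg_AE) (use AE in \<open>auto elim!: eventually_mono\<close>)
    with le have "integral\<^sup>L ?N (\<lambda>y. y - K') = 0" by simp
    then have "AE y in ?N. y - K' = 0"
      by (subst (asm) integral_nonneg_eq_0_iff_AE) (use int AE in \<open>auto elim!: eventually_mono\<close>)
    with AE have "AE y in ?N. False" by eventually_elim simp
    then have "emeasure ?N {0..} = 0" 
      by (subst (asm) AE_iff_measurable[where N = "{0..}"]) (auto simp: sets_borel_Rplus_iff)
    then show "E ?A h = 0" using mass by (simp add: x_def)
  qed
  then have "form_family (line_measure E) K'" if "K \<le> K'" for K'
    using that K by (intro form_family_line_measure[OF ss]) auto
  then show ?thesis by (rule that)
qed

lemma line_measure_eqD:
  assumes F: "semispectral_measure F" and E: "semispectral_measure E"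
    and eq: "line_measure F = line_measure E" and A: "A \<in> sets borel_Rplus"
  shows "F A = E A"
proof (rule quadratic_form_eqI)
  show "bounded_clinear (F A)" "bounded_clinear (E A)"
    using F E A by (auto simp: semispectral_measure_def)
  have A': "A \<in> sets borel" "A \<inter> {0..} = A" using A by (auto simp: sets_borel_Rplus_iff)
  fix h
  have "ennreal (Re (cinner (F A h) h)) = ennreal (Re (cinner (E A h) h))"
    using emeasure_line_measure[OF F A'(1), of h] emeasure_line_measure[OF E A'(1), of h] eq A'(2) by simp
  then have "Re (cinner (F A h) h) = Re (cinner (E A h) h)"
    using semispectral_cinner(2)[OF F A, of h] semispectral_cinner(2)[OF E A, of h] by simp
  then show "cinner (F A h) h = cinner (E A h) h"
    by (subst semispectral_cinner(1)[OF F A], subst semispectral_cinner(1)[OF E A]) simp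
qed

lemma scalar_measure_eqI:
  assumes F: "semispectral_measure F" and E: "semispectral_measure E"
    and eq: "line_measure F = line_measure E"
  shows "scalar_measure F = scalar_measure E"
proof
  fix h
  show "scalar_measure F h = scalar_measure E h"
    by (rule measure_eqI)
      (simp_all add: emeasure_scalar_measure[OF F] emeasure_scalar_measure[OF E] line_measure_eqD[OF F E eq])
qed

section \<open>Definite descriptions, uniqueness of the spectral measure and the functional
  calculus\<close>

lemma has_op_integral_unique: "has_op_integral F f S \<Longrightarrow> has_op_integral F f R \<Longrightarrow> S = R"
  by (rule quadratic_form_eqI) (auto simp: has_op_integral_def)

lemma op_integral_eqI: "has_op_integral F f S \<Longrightarrow> op_integral F f = S"
  unfolding op_integral_def using has_op_integral_unique by (blast intro: the_equality)

text \<open>The describing predicates themselves coincide, so the equation holds even where no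
  integral exists.\<close>

lemma op_integral_cong:
  assumes "\<And>x. 0 \<le> x \<Longrightarrow> f x = g x" shows "op_integral F f = op_integral F g"
proof -
  have "integrable (scalar_measure F h) f \<longleftrightarrow> integrable (scalar_measure F h) g" for h
    by (rule Bochner_Integration.integrable_cong) (simp_all add: assms)
  moreover have "integral\<^sup>L (scalar_measure F h) f = integral\<^sup>L (scalar_measure F h) g" for h
    by (rule Bochner_Integration.integral_cong) (simp_all add: assms)
  ultimately show ?thesis by (simp add: op_integral_def has_op_integral_def)
qed

lemma rep_op_integral:
  assumes fam: "form_family (line_measure F) M" and F: "semispectral_measure F" and f: "bdd_borel M f"
  shows "form_family.rep (line_measure F) f (op_integral F (\<lambda>x. complex_of_real (f x)))"
proof -
  obtain S where "form_family.rep (line_measure F) f S"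
    using form_family.rep_exists[OF fam rep_indicator_semispectral[OF fam F] f] by blast
  then show ?thesis
    using op_integral_eqI has_op_integral_iff_rep[OF fam f] by metis
qed

lemma line_measure_eq_if_two_powers:
  fixes T :: "'a::chilbert_space \<Rightarrow> 'a"
  assumes E: "is_spectral_measure_of E T" and F: "semispectral_measure F"
    and fam: "form_family (line_measure E) M" "form_family (line_measure F) M"
    and ab: "0 < a" "0 < b" "a \<noteq> b"
    and eq: "\<And>p h. p \<in> {a, b} \<Longrightarrow>
      integral\<^sup>L (line_measure F h) (\<lambda>x. x powr p) = integral\<^sup>L (line_measure E h) (\<lambda>x. x powr p)"
  shows "line_measure F = line_measure E"
proof -
  have sp: "spectral_measure E" using E by (simp add: is_spectral_measure_of_def)
  then have ss: "semispectral_measure E" by (simp add: spectral_measure_def)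
  note eqI = form_family_eqI_powr[OF fam(2,1) rep_indicator_semispectral[OF fam(2) F]
      rep_indicator_semispectral[OF fam(1) ss] spectral_idempotent[OF sp]]
  show ?thesis
  proof (cases "a < b")
    case True
    then show ?thesis by (intro eqI[of a b]) (use ab eq in auto)
  next
    case False
    then show ?thesis by (intro eqI[of b a]) (use ab eq in auto)
  qed
qed

text \<open>Multiplicativity makes \<open>T \<circ> T\<close> the integral of the square for either
  measure, so the moments of orders 1 and 2 agree.\<close>

lemma spectral_measure_unique:
  fixes T :: "'a::chilbert_space \<Rightarrow> 'a"
  assumes E: "is_spectral_measure_of E T" and E': "is_spectral_measure_of E' T"
  shows "line_measure E' = line_measure E"
proof -
  obtain M1 M2 where M1: "\<And>M'. M1 \<le> M' \<Longrightarrow> form_family (line_measure E) M'"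
    and M2: "\<And>M'. M2 \<le> M' \<Longrightarrow> form_family (line_measure E') M'"
    using spectral_measure_of_form_family[OF E] spectral_measure_of_form_family[OF E'] by metis
  define M where "M = max M1 M2"
  have fam: "form_family (line_measure E) M" "form_family (line_measure E') M"
    using M1 M2 by (simp_all add: M_def)
  have reps: "form_family.rep (line_measure G) (\<lambda>x. x powr 1) T \<and>
      form_family.rep (line_measure G) (\<lambda>x. x powr 2) (T \<circ> T)"
    if G: "is_spectral_measure_of G T" and fam: "form_family (line_measure G) M" for G
  proof -
    interpret form_family "line_measure G" M by (rule fam)
    have sp: "spectral_measure G" and T: "has_op_integral G (\<lambda>x. complex_of_real x) T"
      using G by (auto simp: is_spectral_measure_of_def)
    then have ss: "semispectral_measure G" by (simp add: spectral_measure_def)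
    have id: "bdd_borel M (\<lambda>x. x)" using bdd_borel_power[of M 1] by simp
    have T: "rep (\<lambda>x. x) T" using T has_op_integral_iff_rep[OF fam id] by simp
    have TT: "rep (\<lambda>x. x * x) (T \<circ> T)"
      by (rule rep_mult_of_idempotent[OF rep_indicator_semispectral[OF fam ss] spectral_idempotent[OF sp] id T id T])
    have "integral\<^sup>L (line_measure G h) (\<lambda>x. x powr 1) = integral\<^sup>L (line_measure G h) (\<lambda>x. x)" for h
      by (intro integral_mu_cong bdd_borel_powr id) auto
    moreover have "integral\<^sup>L (line_measure G h) (\<lambda>x. x powr 2) = integral\<^sup>L (line_measure G h) (\<lambda>x. x * x)" for h
      by (intro integral_mu_cong bdd_borel_powr bdd_borel_mult id) (auto simp: powr_numeral power2_eq_square)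
    ultimately show ?thesis using T TT by (simp add: rep_def)
  qed
  show ?thesis
  proof (rule line_measure_eq_if_two_powers[OF E _ fam, of 1 2])
    show "semispectral_measure E'"
      using E' by (simp add: is_spectral_measure_of_def spectral_measure_def)
    fix p :: real and h assume "p \<in> {1, 2}"
    then show "integral\<^sup>L (line_measure E' h) (\<lambda>x. x powr p) = integral\<^sup>L (line_measure E h) (\<lambda>x. x powr p)"
      using reps[OF E fam(1)] reps[OF E' fam(2)]
        form_family.repD(2)[OF fam(1), of "\<lambda>x. x powr p"] form_family.repD(2)[OF fam(2), of "\<lambda>x. x powr p"]
      by (metis insertE of_real_eq_iff singletonD)
  qed auto
qed

text \<open>All spectral measures of \<open>T\<close> have the same scalar measures, so the
  existential over them collapses to the given \<open>E\<close>. Predicates are compared, hence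
  \<open>f\<close> is arbitrary.\<close>

lemma borel_calculus_eq_op_integral:
  fixes T :: "'a::chilbert_space \<Rightarrow> 'a"
  assumes E: "is_spectral_measure_of E T"
  shows "borel_calculus f T = op_integral E f"
proof -
  have "(\<exists>E'. is_spectral_measure_of E' T \<and> has_op_integral E' f S) \<longleftrightarrow> has_op_integral E f S" for S
  proof
    assume "\<exists>E'. is_spectral_measure_of E' T \<and> has_op_integral E' f S"
    then obtain E' where E': "is_spectral_measure_of E' T" "has_op_integral E' f S" by blast
    have "scalar_measure E' = scalar_measure E"
      using E E'(1) by (intro scalar_measure_eqI spectral_measure_unique[OF E E'(1)])
        (auto simp: is_spectral_measure_of_def spectral_measure_def)
    with E'(2) show "has_op_integral E f S" by (simp add: has_op_integral_def)
  qed (use E in blast)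
  then show ?thesis by (simp add: borel_calculus_def op_integral_def)
qed

lemma rpow_of_nat: "0 \<le> x \<Longrightarrow> rpow x (real n) = x ^ n"
  by (cases "x = 0") (auto simp: rpow_def powr_realpow)

text \<open>\<open>rep_op_integral\<close> shows that both descriptions denote genuine integrals, so
  equal operators yield equal moments. Equality of the line measures then hands both properties of
  \<open>E\<close> over to \<open>F\<close>.\<close>

lemma is_spectral_measure_of_if_two_powers:
  fixes T :: "'a::chilbert_space \<Rightarrow> 'a"
  assumes T: "positive_op T" and F: "semispectral_measure F" and K: "compactly_supported F"
    and ab: "0 < a" "0 < b" "a \<noteq> b"
    and eq: "\<And>p. p \<in> {a, b} \<Longrightarrow> op_power T p = op_integral F (\<lambda>x. complex_of_real (rpow x p))"
  shows "is_spectral_measure_of F T"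
proof -
  obtain E where E: "is_spectral_measure_of E T" using spectral_measure_exists[OF T] by blast
  then have sp: "spectral_measure E" and intT: "has_op_integral E (\<lambda>x. complex_of_real x) T"
    by (auto simp: is_spectral_measure_of_def)
  then have ss: "semispectral_measure E" by (simp add: spectral_measure_def)
  obtain M1 M2 where M1: "\<And>M'. M1 \<le> M' \<Longrightarrow> form_family (line_measure E) M'"
    and M2: "\<And>M'. M2 \<le> M' \<Longrightarrow> form_family (line_measure F) M'"
    using spectral_measure_of_form_family[OF E] compactly_supported_form_family[OF F K] by metis
  define M where "M = max M1 M2"
  have fam: "form_family (line_measure E) M" "form_family (line_measure F) M"
    using M1 M2 by (simp_all add: M_def)
  have line: "line_measure F = line_measure E"
  proof (rule line_measure_eq_if_two_powers[OF E F fam ab])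
    fix p h assume p: "p \<in> {a, b}"
    then have p0: "0 < p" using ab by auto
    have ops: "op_integral E (\<lambda>x. complex_of_real (x powr p)) = op_integral F (\<lambda>x. complex_of_real (x powr p))"
      using eq[OF p] p0 by (simp add: op_power_def borel_calculus_eq_op_integral[OF E] rpow_def)
    have bdd: "bdd_borel M (\<lambda>x. x powr p)" using p0 by (intro bdd_borel_powr) simp
    show "integral\<^sup>L (line_measure F h) (\<lambda>x. x powr p) = integral\<^sup>L (line_measure E h) (\<lambda>x. x powr p)"
      using form_family.repD(2)[OF fam(1) rep_op_integral[OF fam(1) ss bdd], of h]
        form_family.repD(2)[OF fam(2) rep_op_integral[OF fam(2) F bdd], of h] ops
      by simp
  qed
  have "spectral_measure F"
    using sp F line_measure_eqD[OF F ss line] by (simp add: spectral_measure_def)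
  moreover have "has_op_integral F (\<lambda>x. complex_of_real x) T"
    using intT scalar_measure_eqI[OF F ss line] by (simp add: has_op_integral_def)
  ultimately show ?thesis by (simp add: is_spectral_measure_of_def)
qed

text \<open>Condition (i) is taken as \<open>F\<close> being the spectral measure of
  \<open>T\<close>, since a spectral measure unrelated to \<open>T\<close> could not satisfy (ii).
  The step from (ii) back to (i) is the two-exponent case at 1 and 2.\<close>

theorem theorem4p2:
  fixes T :: "'a::chilbert_space \<Rightarrow> 'a"
    and F :: "real set \<Rightarrow> 'a \<Rightarrow> 'a"
    and \<alpha> \<beta> :: real
  assumes "positive_op T"
    and "\<alpha> > 0" and "\<beta> > 0" and "\<alpha> \<noteq> \<beta>"
    and "semispectral_measure F"
    and "compactly_supported F"
  shows "(is_spectral_measure_of F T \<longleftrightarrow>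
            (\<forall>n::nat. op_power T (real n) = op_integral F (\<lambda>x. complex_of_real (x ^ n)))) \<and>
         ((\<forall>n::nat. op_power T (real n) = op_integral F (\<lambda>x. complex_of_real (x ^ n))) \<longleftrightarrow>
            (\<forall>p\<ge>0. op_power T p = op_integral F (\<lambda>x. complex_of_real (rpow x p)))) \<and>
         ((\<forall>p\<ge>0. op_power T p = op_integral F (\<lambda>x. complex_of_real (rpow x p))) \<longleftrightarrow>
            (\<forall>p\<in>{\<alpha>, \<beta>}. op_power T p = op_integral F (\<lambda>x. complex_of_real (rpow x p))))"
    (is "(?i \<longleftrightarrow> ?ii) \<and> (?ii \<longleftrightarrow> ?iii) \<and> (?iii \<longleftrightarrow> ?iv)")
proof -
  have nat_power: "op_integral F (\<lambda>x. complex_of_real (x ^ n)) = op_integral F (\<lambda>x. complex_of_real (rpow x (real n)))" for n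
    by (rule op_integral_cong) (simp add: rpow_of_nat)
  have "?i \<Longrightarrow> ?iii" by (simp add: op_power_def borel_calculus_eq_op_integral)
  moreover have "?iii \<Longrightarrow> ?ii" by (simp add: nat_power del: of_real_power)
  moreover have "?i" if ?ii
  proof (rule is_spectral_measure_of_if_two_powers[OF assms(1,5,6), of 1 2])
    fix p :: real assume "p \<in> {1, 2}"
    then obtain n where "p = real n" by (metis insertE of_nat_1 of_nat_numeral singletonD)
    then show "op_power T p = op_integral F (\<lambda>x. complex_of_real (rpow x p))"
      using that nat_power by simp
  qed auto
  moreover have "?iii \<Longrightarrow> ?iv" using assms(2,3) by auto
  moreover have "?iv \<Longrightarrow> ?i"
    using is_spectral_measure_of_if_two_powers[OF assms(1,5,6,2,3,4)] by blast
  ultimately show ?thesis by blast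
qed

end
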